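(* Let $\mathcal G=(G,\omega)$ be a minimal filling of a finite pseudo-metric space $\mathcal M=(M,\rho)$, where $G$ is a tree without vertices of degree $2$ outside $M$, and suppose that $M$ coincides with the set of degree $1$ vertices of the tree $G$. Let $b$ be the least weight of the boundary edges of the filling $\mathcal G$. Then $-2b\le a_{\mathcal M}$, and hence, for any $a\ge a_{\mathcal M}$, the function $\omega_a$ obtained from $\omega$ by adding $a/2$ to all the weights of the boundary edges is a weight function (i.e. is non-negative). Moreover, for any such $a$, the weighted tree $\mathcal G_a=(G,\omega_a)$ is a minimal filling of the space $\mathcal M+a$. In particular, all the spaces of the form $(M,\lambda\rho+a)$, $\lambda>0$, $a>\lambda a_{\mathcal M}$, have the same set of types of minimal fillings, and all these types are realized among the types of minimal fillings of the spaces $(M,\lambda\rho+\lambda a_{\mathcal M})$, $\lambda\ge0$.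
   Context: In a pseudo-metric space the distance between distinct points may be $0$. A finite graph $G=(V,E)$ joins $M$ if it is connected and $M\subset V$. For a weight function $\omega:E\to[0,\infty)$, $d_\omega(u,v)$ is the least weight (sum of $\omega$ over edges) of a path in $G$ joining $u$ and $v$, and $\omega(G)=\sum_{e\in E}\omega(e)$. The weighted graph $(G,\omega)$ is a filling of $(M,\rho)$ of type $G$ if $G$ joins $M$ and $\rho(p,q)\le d_\omega(p,q)$ for all $p,q\in M$. A minimal filling is a filling whose weight $\omega(G)$ is least among all fillings of the space (over all connected graphs $G$ joining $M$). Convention: the minimal fillings considered are those whose types are trees $G$ all of whose vertices of degree $1$ and $2$ belong to $M$. A boundary edge of $G$ is an edge incident to a vertex of $M$. For $\lambda\ge0$ and $a\in\mathbb R$, $\lambda\rho+a$ is the function with $(\lambda\rho+a)(x,y)=\lambda\rho(x,y)+a$ for distinct $x,y\in M$ and with value $0$ for $x=y$. $\mathcal M+a=(M,\rho+a)$. The number $a_{\mathcal M}\le0$ is the one such that $\rho+a$ is a pseudo-metric for $a\ge a_{\mathcal M}$ and is not a pseudo-metric for $a<a_{\mathcal M}$.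
   Formalization: That G_a is a minimal filling of M+a is stated only when M has at least three points: for two points G is a single edge, whose weight grows by a/2 and not a, so the claim fails for every a ≠ 0. *)

theory Defs
  imports Complex_Main "HOL-Library.Infinite_Typeclass"
begin

definition pseudo_metric :: "'v set \<Rightarrow> ('v \<Rightarrow> 'v \<Rightarrow> real) \<Rightarrow> bool" where
  "pseudo_metric M \<rho> \<longleftrightarrow>
     (\<forall>x\<in>M. \<rho> x x = 0) \<and>
     (\<forall>x\<in>M. \<forall>y\<in>M. 0 \<le> \<rho> x y \<and> \<rho> x y = \<rho> y x) \<and>
     (\<forall>x\<in>M. \<forall>y\<in>M. \<forall>z\<in>M. \<rho> x z \<le> \<rho> x y + \<rho> y z)"

text \<open>The function \<open>\<lambda>\<rho> + a\<close>: the shift by \<open>a\<close> applies off the diagonal only.\<close>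

definition affine_dist :: "real \<Rightarrow> ('v \<Rightarrow> 'v \<Rightarrow> real) \<Rightarrow> real \<Rightarrow> 'v \<Rightarrow> 'v \<Rightarrow> real" where
  "affine_dist l \<rho> a x y = (if x = y then 0 else l * \<rho> x y + a)"

text \<open>The number \<open>a\<^sub>M\<close>. It exists, and is unique, when \<open>M\<close> is finite with at least two points
  (lemma \<open>shift_threshold_iff\<close>).\<close>

definition shift_threshold :: "'v set \<Rightarrow> ('v \<Rightarrow> 'v \<Rightarrow> real) \<Rightarrow> real" where
  "shift_threshold M \<rho> =
     (THE t. (\<forall>a\<ge>t. pseudo_metric M (affine_dist 1 \<rho> a)) \<and>
             (\<forall>a<t. \<not> pseudo_metric M (affine_dist 1 \<rho> a)))"

text \<open>Finite simple undirected graphs, given by a vertex set and a set of two-element edges.\<close>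

definition finite_graph :: "'v set \<Rightarrow> 'v set set \<Rightarrow> bool" where
  "finite_graph V E \<longleftrightarrow> finite V \<and> V \<noteq> {} \<and> (\<forall>e\<in>E. e \<subseteq> V \<and> card e = 2)"

definition path_between :: "'v set \<Rightarrow> 'v set set \<Rightarrow> 'v \<Rightarrow> 'v \<Rightarrow> 'v list \<Rightarrow> bool" where
  "path_between V E u v p \<longleftrightarrow>
     p \<noteq> [] \<and> hd p = u \<and> last p = v \<and> distinct p \<and> set p \<subseteq> V \<and>
     successively (\<lambda>x y. {x, y} \<in> E) p"

definition connected_graph :: "'v set \<Rightarrow> 'v set set \<Rightarrow> bool" where
  "connected_graph V E \<longleftrightarrow>
     finite_graph V E \<and> (\<forall>u\<in>V. \<forall>v\<in>V. \<exists>p. path_between V E u v p)"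

definition graph_cycle :: "'v set \<Rightarrow> 'v set set \<Rightarrow> 'v list \<Rightarrow> bool" where
  "graph_cycle V E p \<longleftrightarrow>
     3 \<le> length p \<and> path_between V E (hd p) (last p) p \<and> {last p, hd p} \<in> E"

definition tree_graph :: "'v set \<Rightarrow> 'v set set \<Rightarrow> bool" where
  "tree_graph V E \<longleftrightarrow> connected_graph V E \<and> (\<nexists>p. graph_cycle V E p)"

definition vertex_degree :: "'v set set \<Rightarrow> 'v \<Rightarrow> nat" where
  "vertex_degree E v = card {e \<in> E. v \<in> e}"

definition joins :: "'v set \<Rightarrow> 'v set set \<Rightarrow> 'v set \<Rightarrow> bool" where
  "joins V E M \<longleftrightarrow> connected_graph V E \<and> M \<subseteq> V"

text \<open>Only the values of a weight function on the edges matter.\<close>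

definition weight_function :: "'v set set \<Rightarrow> ('v set \<Rightarrow> real) \<Rightarrow> bool" where
  "weight_function E \<omega> \<longleftrightarrow> (\<forall>e\<in>E. 0 \<le> \<omega> e)"

definition graph_weight :: "'v set set \<Rightarrow> ('v set \<Rightarrow> real) \<Rightarrow> real" where
  "graph_weight E \<omega> = (\<Sum>e\<in>E. \<omega> e)"

definition path_weight :: "('v set \<Rightarrow> real) \<Rightarrow> 'v list \<Rightarrow> real" where
  "path_weight \<omega> p = (\<Sum>i<length p - 1. \<omega> {p ! i, p ! Suc i})"

text \<open>A finite graph has finitely many paths, since vertices do not repeat along a path; so the
  minimum is attained whenever \<open>u\<close> and \<open>v\<close> are joined by a path.\<close>

definition weight_dist ::
  "'v set \<Rightarrow> 'v set set \<Rightarrow> ('v set \<Rightarrow> real) \<Rightarrow> 'v \<Rightarrow> 'v \<Rightarrow> real" where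
  "weight_dist V E \<omega> u v = Min (path_weight \<omega> ` {p. path_between V E u v p})"

definition filling ::
  "'v set \<Rightarrow> ('v \<Rightarrow> 'v \<Rightarrow> real) \<Rightarrow> 'v set \<Rightarrow> 'v set set \<Rightarrow> ('v set \<Rightarrow> real) \<Rightarrow> bool" where
  "filling M \<rho> V E \<omega> \<longleftrightarrow>
     joins V E M \<and> weight_function E \<omega> \<and> (\<forall>p\<in>M. \<forall>q\<in>M. \<rho> p q \<le> weight_dist V E \<omega> p q)"

text \<open>Vertices, in particular the points of \<open>M\<close>, are elements of an infinite type: every finite
  graph containing the finite set \<open>M\<close> is then isomorphic, by an isomorphism fixing \<open>M\<close>, to one
  with vertices in \<^typ>\<open>'v\<close>, so the minimum below is over all connected graphs joining \<open>M\<close>. Over a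
  finite type, vertices outside \<open>M\<close> might not be available.\<close>

definition minimal_filling ::
  "('v::infinite) set \<Rightarrow> ('v \<Rightarrow> 'v \<Rightarrow> real) \<Rightarrow> 'v set \<Rightarrow> 'v set set \<Rightarrow> ('v set \<Rightarrow> real) \<Rightarrow> bool"
  where
  "minimal_filling M \<rho> V E \<omega> \<longleftrightarrow>
     filling M \<rho> V E \<omega> \<and>
     (\<forall>V' E' \<omega>'. filling M \<rho> V' E' \<omega>' \<longrightarrow> graph_weight E \<omega> \<le> graph_weight E' \<omega>')"

text \<open>The types of minimal fillings, under the convention that a type is a tree all of whose
  vertices of degree 1 and 2 belong to \<open>M\<close>.\<close>

definition minimal_filling_types ::
  "('v::infinite) set \<Rightarrow> ('v \<Rightarrow> 'v \<Rightarrow> real) \<Rightarrow> ('v set \<times> 'v set set) set" where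
  "minimal_filling_types M \<rho> =
     {(V, E). tree_graph V E \<and> (\<forall>v\<in>V. vertex_degree E v \<in> {1, 2} \<longrightarrow> v \<in> M) \<and>
              (\<exists>\<omega>. minimal_filling M \<rho> V E \<omega>)}"

definition boundary_edges :: "'v set \<Rightarrow> 'v set set \<Rightarrow> 'v set set" where
  "boundary_edges M E = {e \<in> E. e \<inter> M \<noteq> {}}"

text \<open>The function \<open>\<omega>\<^sub>a\<close>. Each boundary edge receives \<open>a/2\<close> once, also if both of its ends are in
  \<open>M\<close>. When \<open>M\<close> is the set of leaves of a tree the latter happens only if \<open>M\<close> has two points and
  the tree is a single edge; then the path joining these points gains only \<open>a/2\<close>, not \<open>a\<close>.\<close>

definition shifted_weight ::
  "'v set \<Rightarrow> 'v set set \<Rightarrow> ('v set \<Rightarrow> real) \<Rightarrow> real \<Rightarrow> 'v set \<Rightarrow> real" where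
  "shifted_weight M E \<omega> a e = (if e \<in> boundary_edges M E then \<omega> e + a / 2 else \<omega> e)"

lemma shift_threshold_iff:
  assumes fin: "finite M" and two: "2 \<le> card M" and pm: "pseudo_metric M \<rho>"
  shows "pseudo_metric M (affine_dist 1 \<rho> a) \<longleftrightarrow> shift_threshold M \<rho> \<le> a"
proof -
  define S where "S = (\<lambda>(x, y). - \<rho> x y) ` {(x, y). x \<in> M \<and> y \<in> M \<and> x \<noteq> y} \<union>
    (\<lambda>(x, y, z). \<rho> x z - \<rho> x y - \<rho> y z) `
      {(x, y, z). x \<in> M \<and> y \<in> M \<and> z \<in> M \<and> x \<noteq> y \<and> y \<noteq> z \<and> x \<noteq> z}"
  have "finite {(x, y). x \<in> M \<and> y \<in> M \<and> x \<noteq> y}"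
    by (rule finite_subset[of _ "M \<times> M"]) (use fin in auto)
  moreover have "finite {(x, y, z). x \<in> M \<and> y \<in> M \<and> z \<in> M \<and> x \<noteq> y \<and> y \<noteq> z \<and> x \<noteq> z}"
    by (rule finite_subset[of _ "M \<times> M \<times> M"]) (use fin in auto)
  ultimately have finS: "finite S" by (simp add: S_def)
  obtain x y where "x \<in> M" "y \<in> M" "x \<noteq> y"
    using two fin by (metis card_le_Suc0_iff_eq not_less_eq_eq numeral_2_eq_2)
  then have neS: "S \<noteq> {}" by (auto simp: S_def)
  have iff: "pseudo_metric M (affine_dist 1 \<rho> c) \<longleftrightarrow> Max S \<le> c" for c
  proof -
    have "Max S \<le> c \<longleftrightarrow> (\<forall>s\<in>S. s \<le> c)" using finS neS by simp
    also have "\<dots> \<longleftrightarrow> (\<forall>x\<in>M. \<forall>y\<in>M. x \<noteq> y \<longrightarrow> - \<rho> x y \<le> c) \<and>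
        (\<forall>x\<in>M. \<forall>y\<in>M. \<forall>z\<in>M. x \<noteq> y \<and> y \<noteq> z \<and> x \<noteq> z \<longrightarrow> \<rho> x z - \<rho> x y - \<rho> y z \<le> c)"
      unfolding S_def by (simp add: ball_Un) blast
    also have "\<dots> \<longleftrightarrow> pseudo_metric M (affine_dist 1 \<rho> c)"
      (is "?A \<and> ?B \<longleftrightarrow> _")
    proof
      assume AB: "?A \<and> ?B"
      have sym: "\<And>x y. x \<in> M \<Longrightarrow> y \<in> M \<Longrightarrow> \<rho> x y = \<rho> y x"
        using pm unfolding pseudo_metric_def by blast
      have nn: "0 \<le> affine_dist 1 \<rho> c x y" if "x \<in> M" "y \<in> M" for x y
        using AB that by (force simp: affine_dist_def)
      have "affine_dist 1 \<rho> c x z \<le> affine_dist 1 \<rho> c x y + affine_dist 1 \<rho> c y z"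
        if "x \<in> M" "y \<in> M" "z \<in> M" for x y z
      proof (cases "x \<noteq> y \<and> y \<noteq> z \<and> x \<noteq> z")
        case True
        then have "\<rho> x z - \<rho> x y - \<rho> y z \<le> c" using AB that by blast
        then show ?thesis using True by (simp add: affine_dist_def)
      next
        case False
        then show ?thesis using nn[of x y] nn[of y z] that by (auto simp: affine_dist_def)
      qed
      then show "pseudo_metric M (affine_dist 1 \<rho> c)"
        unfolding pseudo_metric_def using nn sym by (auto simp: affine_dist_def)
    next
      assume P: "pseudo_metric M (affine_dist 1 \<rho> c)"
      have ?A
      proof (intro ballI impI)
        fix x y assume "x \<in> M" "y \<in> M" "x \<noteq> y"
        moreover from this have "0 \<le> affine_dist 1 \<rho> c x y"
          using P unfolding pseudo_metric_def by blast
        ultimately show "- \<rho> x y \<le> c" by (simp add: affine_dist_def)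
      qed
      moreover have ?B
      proof (intro ballI impI)
        fix x y z assume "x \<in> M" "y \<in> M" "z \<in> M" "x \<noteq> y \<and> y \<noteq> z \<and> x \<noteq> z"
        moreover from this
        have "affine_dist 1 \<rho> c x z \<le> affine_dist 1 \<rho> c x y + affine_dist 1 \<rho> c y z"
          using P unfolding pseudo_metric_def by blast
        ultimately show "\<rho> x z - \<rho> x y - \<rho> y z \<le> c" by (simp add: affine_dist_def)
      qed
      ultimately show "?A \<and> ?B" ..
    qed
    finally show ?thesis by simp
  qed
  have "shift_threshold M \<rho> = Max S"
    unfolding shift_threshold_def iff
  proof (rule the_equality)
    fix t assume t: "(\<forall>a\<ge>t. Max S \<le> a) \<and> (\<forall>a<t. \<not> Max S \<le> a)"
    then have "Max S \<le> t" by blast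
    moreover have "\<not> Max S < t" using t by blast
    ultimately show "t = Max S" by linarith
  qed auto
  then show ?thesis using iff by simp
qed

end

theory Submission
  imports Defs
begin

text \<open>The proof compares fillings of \<open>\<rho>\<close> with fillings of \<open>\<rho> + c\<close>, \<open>c \<ge> 0\<close>, by two operations on
  arbitrary weighted graphs. Hanging each point of \<open>M\<close> on a new pendant edge of weight \<open>c / 2\<close>
  turns a filling of \<open>\<rho>\<close> into one of \<open>\<rho> + c\<close> (\<open>filling_add_pendants\<close>). Conversely, in a filling of
  \<open>\<rho> + c\<close> the open balls of radius \<open>c / 2\<close> around the points of \<open>M\<close> are disjoint, and shrinking
  each of them to a point gives a filling of \<open>\<rho>\<close> (\<open>filling_shrink_balls\<close>). This removes the total
  length of the balls, and each ball has length at least \<open>c / 2\<close> if \<open>|M| \<ge> 2\<close>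
  (\<open>ball_length_ge\<close>). So the minimal weights of \<open>\<rho>\<close> and \<open>\<rho> + c\<close> differ by \<open>|M| c / 2\<close>.

  Shrinking the balls of a minimal filling of \<open>\<rho> + c\<close> and then adding pendant edges shows that its
  balls have length exactly \<open>c / 2\<close> (\<open>minimal_filling_ball_length_le\<close>): a ball cannot branch. In a
  tree this has two consequences. If the leaves are the points of \<open>M\<close> and other vertices have degree
  at least 3, every boundary edge has weight at least \<open>c / 2\<close>, since otherwise a ball would branch at
  the inner end of the edge (\<open>minimal_filling_boundary_edge_ge\<close>). With \<open>\<rho> + a\<^sub>M\<close> and \<open>- a\<^sub>M\<close> in the
  roles of \<open>\<rho>\<close> and \<open>c\<close> this is the bound \<open>- 2 b \<le> a\<^sub>M\<close>. And if \<open>c > 0\<close>, every point of \<open>M\<close> is a leaf,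
  since otherwise its ball would branch at its centre (\<open>minimal_filling_degree_eq_1\<close>).

  When \<open>M\<close> is the set of leaves and has at least three points, a path between two points of \<open>M\<close>
  contains exactly two boundary edges. So \<open>\<omega>\<^sub>a\<close> is a filling of \<open>\<rho> + a\<close>, of weight
  \<open>\<omega>(G) + |M| a / 2\<close>, and it is minimal by the comparison of minimal weights
  (\<open>minimal_filling_shift\<close>). For the statements on types, all spaces in question are, up to a factor,
  shifts of \<open>\<rho> + a\<^sub>M\<close>, and if the shift is positive the types have \<open>M\<close> as their set of leaves
  (\<open>minimal_filling_types_shift\<close>). The remaining cases, \<open>|M| = 2\<close> and the factor 0, are settled by
  scaling.\<close>

section \<open>Walks, paths and their weights\<close>

abbreviation walk :: "'v set set \<Rightarrow> 'v list \<Rightarrow> bool" where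
  "walk E p \<equiv> successively (\<lambda>x y. {x, y} \<in> E) p"

lemma path_weight_single [simp]: "path_weight f [x] = 0"
  by (simp add: path_weight_def)

lemma path_weight_Cons [simp]:
  "path_weight f (x # y # ys) = f {x, y} + path_weight f (y # ys)"
  by (simp add: path_weight_def sum.lessThan_Suc_shift del: sum.lessThan_Suc)

lemma path_weight_split:
  "path_weight f (xs @ v # ys) = path_weight f (xs @ [v]) + path_weight f (v # ys)"
proof (induction xs)
  case (Cons x xs)
  then show ?case by (cases xs) auto
qed simp

lemma path_weight_cong:
  assumes "\<And>x y. x \<in> set p \<Longrightarrow> y \<in> set p \<Longrightarrow> {x, y} \<in> E \<Longrightarrow> f {x, y} = g {x, y}" and "walk E p"
  shows "path_weight f p = path_weight g p"
  using assms
proof (induction p rule: induct_list012)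
  case (3 x y zs)
  then show ?case by simp
qed (simp_all add: path_weight_def)

lemma path_weight_nonneg:
  assumes "\<forall>e\<in>E. 0 \<le> f e" and "walk E p"
  shows "0 \<le> path_weight f p"
  using assms(2)
proof (induction p rule: induct_list012)
  case (3 x y zs)
  then show ?case using assms(1) by simp
qed (simp_all add: path_weight_def)

lemma path_weight_scale: "path_weight (\<lambda>e. k * f e) p = k * path_weight f p"
  by (simp add: path_weight_def sum_distrib_left)

text \<open>The edges of a path are distinct, because its vertices are.\<close>

lemma path_weight_le_sum:
  assumes "finite E" and nonneg: "\<forall>e\<in>E. 0 \<le> f e" and "distinct p" and "walk E p"
  shows "path_weight f p \<le> sum f E"
proof -
  have "path_weight f p \<le> sum f {e \<in> E. e \<subseteq> set p}"
    using assms(3,4)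
  proof (induction p rule: induct_list012)
    case (3 x y zs)
    have "sum f (insert {x, y} {e \<in> E. e \<subseteq> set (y # zs)}) \<le> sum f {e \<in> E. e \<subseteq> set (x # y # zs)}"
      using 3 \<open>finite E\<close> nonneg by (intro sum_mono2) auto
    moreover have "{x, y} \<notin> {e \<in> E. e \<subseteq> set (y # zs)}" using 3 by auto
    ultimately show ?case using 3 \<open>finite E\<close> by simp
  qed (use nonneg in \<open>auto simp: path_weight_def intro: sum_nonneg\<close>)
  also have "\<dots> \<le> sum f E" using \<open>finite E\<close> nonneg by (intro sum_mono2) auto
  finally show ?thesis .
qed

lemma walk_invariant:
  assumes step: "\<And>x u v. {u, v} \<in> E \<Longrightarrow> J x u \<Longrightarrow> J (x + f {u, v}) v"
    and "walk E p" and "p \<noteq> []" and "J x (hd p)"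
  shows "J (x + path_weight f p) (last p)"
  using assms(2-)
proof (induction p arbitrary: x rule: induct_list012)
  case (3 a b zs)
  then have "J (x + f {a, b}) b" using step[of a b x] by simp
  then have "J (x + f {a, b} + path_weight f (b # zs)) (last (b # zs))" using 3 by simp
  then show ?case by (simp add: add.assoc)
qed simp_all

text \<open>A function that is 1-Lipschitz along every edge bounds path weights from below.\<close>

lemma potential_le_path_weight:
  fixes \<phi> :: "'v \<Rightarrow> real"
  assumes "\<And>u v. {u, v} \<in> E \<Longrightarrow> \<phi> v \<le> \<phi> u + f {u, v}" and "walk E p" and "p \<noteq> []"
  shows "\<phi> (last p) \<le> \<phi> (hd p) + path_weight f p"
proof (rule walk_invariant[where J = "\<lambda>x u. \<phi> u \<le> x"])
  show "\<phi> v \<le> x + f {u, v}" if "{u, v} \<in> E" "\<phi> u \<le> x" for x u v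
    using assms(1)[OF that(1)] that(2) by linarith
qed (use assms in auto)

section \<open>Connectivity and the distance of a weighted graph\<close>

lemma edge_vertices:
  assumes "finite_graph V E" and "{u, v} \<in> E"
  shows "u \<in> V" and "v \<in> V" and "u \<noteq> v"
  using assms by (force simp: finite_graph_def)+

lemma finite_graph_finite_edges: "finite_graph V E \<Longrightarrow> finite E"
  unfolding finite_graph_def by (metis Pow_iff finite_Pow_iff finite_subset subsetI)

lemma edge_as_pair:
  assumes "finite_graph V E" and "e \<in> E"
  obtains u v where "e = {u, v}" "u \<noteq> v"
proof -
  have "card e = 2" using assms by (simp add: finite_graph_def)
  then show thesis using that by (auto simp: card_2_iff)
qed

lemma incident_edge:
  assumes "finite_graph V E" and "e \<in> E" and "v \<in> e"
  obtains w where "e = {v, w}"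
proof -
  obtain x y where "e = {x, y}" using edge_as_pair[OF assms(1,2)] by metis
  then show thesis using that[of x] that[of y] assms(3) by (auto simp: insert_commute)
qed

lemma leaf_unique_neighbour:
  assumes "vertex_degree E p = 1" and "{p, x} \<in> E" and "{p, y} \<in> E"
  shows "x = y"
proof -
  obtain e where e: "{e \<in> E. p \<in> e} = {e}"
    using assms(1) unfolding vertex_degree_def by (metis One_nat_def card_1_singleton_iff)
  moreover have "{p, x} \<in> {e \<in> E. p \<in> e}" "{p, y} \<in> {e \<in> E. p \<in> e}" using assms by auto
  ultimately have "{p, x} = {p, y}" by simp
  then show ?thesis by (auto simp: doubleton_eq_iff)
qed

lemma leaf_edge:
  assumes "finite_graph V E" and "vertex_degree E p = 1"
  obtains w where "{p, w} \<in> E"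
proof -
  have "{e \<in> E. p \<in> e} \<noteq> {}"
    using assms(2) unfolding vertex_degree_def by (metis card.empty zero_neq_one)
  then obtain e where "e \<in> E" "p \<in> e" by blast
  then show thesis using incident_edge[OF assms(1)] that by metis
qed

lemma path_snoc_or_shortcut:
  assumes "finite_graph V E" and nonneg: "\<forall>e\<in>E. 0 \<le> f e"
    and p: "path_between V E u v p" and e: "{v, w} \<in> E"
  obtains q where "path_between V E u w q" "path_weight f q \<le> path_weight f p + f {v, w}"
proof (cases "w \<in> set p")
  case False
  have "path_between V E u w (p @ [w])"
    using p e False edge_vertices[OF assms(1) e]
    by (auto simp: path_between_def successively_append_iff)
  moreover have "path_weight f (p @ [w]) = path_weight f p + f {v, w}"
  proof -
    have "p = butlast p @ [v]" using p by (metis append_butlast_last_id path_between_def)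
    then have "path_weight f (p @ [w]) = path_weight f (butlast p @ v # [w])"
      by (metis append.assoc append_Cons append_Nil)
    then show ?thesis
      using \<open>p = butlast p @ [v]\<close> by (simp add: path_weight_split[of f "butlast p" v "[w]"])
  qed
  ultimately show thesis using that by (metis order_refl)
next
  case True
  then obtain a b where ab: "p = a @ w # b" by (meson split_list)
  have wab: "walk E (a @ [w])" "walk E (w # b)"
    using p ab by (auto simp: path_between_def successively_append_iff successively_Cons)
  have "path_between V E u w (a @ [w])"
    using p ab wab by (cases a) (auto simp: path_between_def)
  moreover have "path_weight f (a @ [w]) \<le> path_weight f p + f {v, w}"
    using path_weight_nonneg[OF nonneg wab(2)] nonneg e ab
    by (simp add: path_weight_split[of f a w b])
  ultimately show thesis using that by blast
qed

text \<open>The relation of being joined by an edge. Its reflexive transitive closure expresses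
  connectivity.\<close>

definition adjacency :: "'v set set \<Rightarrow> ('v \<times> 'v) set" where
  "adjacency E = {(x, y). {x, y} \<in> E}"

lemma path_of_adjacency_rtrancl:
  assumes "finite_graph V E" and "u \<in> V" and "(u, v) \<in> (adjacency E)\<^sup>*"
  shows "\<exists>p. path_between V E u v p"
  using assms(3)
proof (induction rule: rtrancl_induct)
  case base
  have "path_between V E u u [u]" using assms(2) by (simp add: path_between_def)
  then show ?case ..
next
  case (step y z)
  then obtain p where "path_between V E u y p" by blast
  moreover have "{y, z} \<in> E" using step by (simp add: adjacency_def)
  ultimately show ?case
    using path_snoc_or_shortcut[OF assms(1), where f = "\<lambda>_. 0"] by (metis order_refl)
qed

lemma adjacency_rtrancl_of_walk:
  "walk E p \<Longrightarrow> p \<noteq> [] \<Longrightarrow> (hd p, last p) \<in> (adjacency E)\<^sup>*"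
proof (induction p rule: induct_list012)
  case (3 x y zs)
  then have "(x, y) \<in> adjacency E" by (simp add: adjacency_def)
  then show ?case using 3 by (auto intro: converse_rtrancl_into_rtrancl)
qed auto

lemma sym_adjacency_rtrancl: "sym ((adjacency E)\<^sup>*)"
  by (rule sym_rtrancl) (auto simp: sym_def adjacency_def insert_commute)

lemma connected_graphD:
  assumes "connected_graph V E" "u \<in> V" "v \<in> V"
  shows "(u, v) \<in> (adjacency E)\<^sup>*"
  using assms adjacency_rtrancl_of_walk unfolding connected_graph_def path_between_def by metis

lemma ex_edge_at_vertex:
  assumes "connected_graph V E" and "u \<in> V" "v \<in> V" "u \<noteq> v"
  obtains w where "{u, w} \<in> E"
proof -
  have "(u, v) \<in> (adjacency E)\<^sup>*" by (rule connected_graphD[OF assms(1-3)])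
  then obtain w where "(u, w) \<in> adjacency E" using assms(4) by (metis converse_rtranclE)
  then show thesis using that by (simp add: adjacency_def)
qed

lemma connected_graphI:
  assumes "finite_graph V E" and "\<And>u. u \<in> V \<Longrightarrow> (r, u) \<in> (adjacency E)\<^sup>*"
  shows "connected_graph V E"
  unfolding connected_graph_def
proof (intro conjI ballI assms(1))
  fix u v assume uv: "u \<in> V" "v \<in> V"
  then have "(u, r) \<in> (adjacency E)\<^sup>*"
    using assms(2) sym_adjacency_rtrancl by (metis symD)
  then have "(u, v) \<in> (adjacency E)\<^sup>*" using assms(2)[OF uv(2)] by (rule rtrancl_trans)
  then show "\<exists>p. path_between V E u v p"
    using path_of_adjacency_rtrancl assms(1) uv(1) by metis
qed

lemma finite_paths: "finite_graph V E \<Longrightarrow> finite {p. path_between V E u v p}"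
  by (rule finite_subset[OF _ finite_subset_distinct[of V]])
     (auto simp: path_between_def finite_graph_def)

context
  fixes V :: "'v set" and E :: "'v set set"
  assumes conn: "connected_graph V E"
begin

lemma weight_dist_le:
  assumes "path_between V E u v p"
  shows "weight_dist V E \<omega> u v \<le> path_weight \<omega> p"
  using assms conn finite_paths[of V E u v]
  unfolding weight_dist_def connected_graph_def by (intro Min_le) auto

lemma weight_dist_attained:
  assumes "u \<in> V" "v \<in> V"
  obtains p where "path_between V E u v p" "weight_dist V E \<omega> u v = path_weight \<omega> p"
proof -
  have "weight_dist V E \<omega> u v \<in> path_weight \<omega> ` {p. path_between V E u v p}"
    unfolding weight_dist_def using assms conn finite_paths[of V E u v]
    by (intro Min_in) (auto simp: connected_graph_def)
  then show thesis using that by auto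
qed

lemma weight_dist_ge:
  assumes "u \<in> V" "v \<in> V" and "\<And>p. path_between V E u v p \<Longrightarrow> t \<le> path_weight \<omega> p"
  shows "t \<le> weight_dist V E \<omega> u v"
  using weight_dist_attained[OF assms(1,2)] assms(3) by metis

lemma weight_dist_self:
  assumes "u \<in> V"
  shows "weight_dist V E \<omega> u u = 0"
proof -
  obtain p where p: "path_between V E u u p" "weight_dist V E \<omega> u u = path_weight \<omega> p"
    using weight_dist_attained assms by blast
  then have "p = [u]"
    by (cases p) (auto simp: path_between_def split: if_splits)
  then show ?thesis using p by simp
qed

context
  fixes \<omega> :: "'v set \<Rightarrow> real"
  assumes nonneg: "weight_function E \<omega>"
begin

lemma weight_dist_edge:
  assumes "{u, v} \<in> E" and "r \<in> V"
  shows "weight_dist V E \<omega> r v \<le> weight_dist V E \<omega> r u + \<omega> {u, v}"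
proof -
  have fg: "finite_graph V E" using conn by (simp add: connected_graph_def)
  obtain p where p: "path_between V E r u p" "weight_dist V E \<omega> r u = path_weight \<omega> p"
    using weight_dist_attained assms edge_vertices[OF fg] by metis
  obtain q where "path_between V E r v q" "path_weight \<omega> q \<le> path_weight \<omega> p + \<omega> {u, v}"
    using path_snoc_or_shortcut[OF fg _ p(1) assms(1)] nonneg unfolding weight_function_def by metis
  then show ?thesis using weight_dist_le[of r v q \<omega>] p by linarith
qed

lemma weight_dist_triangle:
  assumes "r \<in> V" "s \<in> V" "v \<in> V"
  shows "weight_dist V E \<omega> r s \<le> weight_dist V E \<omega> r v + weight_dist V E \<omega> s v"
proof -
  obtain p where p: "path_between V E s v p" "weight_dist V E \<omega> s v = path_weight \<omega> p"
    using weight_dist_attained assms by metis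
  have "- weight_dist V E \<omega> r (last p) \<le> - weight_dist V E \<omega> r (hd p) + path_weight \<omega> p"
  proof (rule potential_le_path_weight[where E = E])
    fix a b assume "{a, b} \<in> E"
    then show "- weight_dist V E \<omega> r b \<le> - weight_dist V E \<omega> r a + \<omega> {a, b}"
      using weight_dist_edge[of b a r] assms(1) by (simp add: insert_commute)
  qed (use p in \<open>auto simp: path_between_def\<close>)
  then show ?thesis using p by (simp add: path_between_def)
qed

end

end

lemma filling_cong:
  assumes "\<And>x y. x \<in> M \<Longrightarrow> y \<in> M \<Longrightarrow> \<rho> x y = \<rho>' x y"
  shows "filling M \<rho> V E \<omega> \<longleftrightarrow> filling M \<rho>' V E \<omega>"
  using assms by (simp add: filling_def)

lemma minimal_filling_cong:
  assumes "\<And>x y. x \<in> M \<Longrightarrow> y \<in> M \<Longrightarrow> \<rho> x y = \<rho>' x y"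
  shows "minimal_filling M \<rho> V E \<omega> \<longleftrightarrow> minimal_filling M \<rho>' V E \<omega>"
proof -
  have "filling M \<rho> = filling M \<rho>'"
    by (intro ext filling_cong assms)
  then show ?thesis unfolding minimal_filling_def by simp
qed

lemma fillingD:
  assumes "filling M \<rho> V E \<omega>"
  shows "connected_graph V E" "finite_graph V E" "M \<subseteq> V" "weight_function E \<omega>"
    and "\<And>p q. p \<in> M \<Longrightarrow> q \<in> M \<Longrightarrow> \<rho> p q \<le> weight_dist V E \<omega> p q"
  using assms by (auto simp: filling_def joins_def connected_graph_def)

section \<open>Lengthening all pendant edges\<close>

text \<open>Hanging every point of \<open>M\<close> on a new edge of weight \<open>c / 2\<close> turns a filling of \<open>\<rho>\<close> into one
  of \<open>\<rho> + c\<close>. Since the points of \<open>M\<close> have to be the free ends of the new edges, the old vertices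
  are renamed by an injection \<open>g\<close> that avoids \<open>M\<close>.\<close>

lemma filling_add_pendants:
  fixes M :: "('v::infinite) set"
  assumes "finite M" and "0 \<le> c" and fill: "filling M \<rho> V E \<omega>"
  obtains V' E' \<omega>' where "filling M (affine_dist 1 \<rho> c) V' E' \<omega>'"
    "graph_weight E' \<omega>' = graph_weight E \<omega> + card M * (c / 2)"
proof -
  note f = fillingD[OF fill]
  have fV: "finite V" "V \<noteq> {}" using f(2) by (auto simp: finite_graph_def)
  have "infinite (- M)" using \<open>finite M\<close> infinite_UNIV by (simp add: Compl_eq_Diff_UNIV)
  then obtain B where B: "B \<subseteq> - M" "finite B" "card B = card V"
    using infinite_arbitrarily_large by metis
  then obtain g where g: "bij_betw g V B" using finite_same_card_bij fV by metis
  then have inj: "inj_on g V" by (simp add: bij_betw_def)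
  have gM: "g u \<notin> M" if "u \<in> V" for u using g B that by (auto simp: bij_betw_def)
  define k where "k = inv_into V g"
  have kg: "k (g u) = u" if "u \<in> V" for u using inj that by (simp add: k_def)
  have eV: "e \<subseteq> V" "card e = 2" if "e \<in> E" for e using f(2) that by (auto simp: finite_graph_def)
  \<comment> \<open>\<open>Eg\<close> is the renamed graph and \<open>Ep\<close> the set of new edges. The latter meet \<open>M\<close>, the former
    do not.\<close>
  define V' where "V' = g ` V \<union> M"
  define Eg where "Eg = (\<lambda>e. g ` e) ` E"
  define Ep where "Ep = (\<lambda>p. {p, g p}) ` M"
  define \<omega>' where "\<omega>' e = (if e \<inter> M = {} then \<omega> (k ` e) else c / 2)" for e
  have \<omega>g: "\<omega>' (g ` e) = \<omega> e" if "e \<in> E" for e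
  proof -
    have "g ` e \<inter> M = {}" using gM eV[OF that] by auto
    moreover have "k ` g ` e = e" using eV[OF that] inj by (simp add: k_def inv_into_image_cancel)
    ultimately show ?thesis by (simp add: \<omega>'_def)
  qed
  have \<omega>p: "\<omega>' {p, g p} = c / 2" if "p \<in> M" for p using that by (simp add: \<omega>'_def)
  have fin': "finite_graph V' (Eg \<union> Ep)"
    unfolding finite_graph_def
  proof (intro conjI ballI)
    show "finite V'" "V' \<noteq> {}" using fV \<open>finite M\<close> by (auto simp: V'_def)
    fix e assume "e \<in> Eg \<union> Ep"
    moreover have "g ` e \<subseteq> V' \<and> card (g ` e) = 2" if "e \<in> E" for e
      using eV[OF that] inj by (auto simp: V'_def card_image inj_on_subset)
    moreover have "{p, g p} \<subseteq> V' \<and> card {p, g p} = 2" if "p \<in> M" for p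
    proof -
      have "p \<in> V" using that f(3) by blast
      moreover from this have "p \<noteq> g p" using gM that by metis
      ultimately show ?thesis using that by (auto simp: V'_def)
    qed
    ultimately show "e \<subseteq> V'" "card e = 2" by (auto simp: Eg_def Ep_def)
  qed
  obtain r where r: "r \<in> V" using fV by blast
  have conn': "connected_graph V' (Eg \<union> Ep)"
  proof (rule connected_graphI[OF fin'])
    have old: "(g r, g u) \<in> (adjacency (Eg \<union> Ep))\<^sup>*" if "u \<in> V" for u
      using connected_graphD[OF f(1) r that]
    proof (induction rule: rtrancl_induct)
      case (step y z)
      then have "{y, z} \<in> E" by (simp add: adjacency_def)
      then have "g ` {y, z} \<in> Eg" unfolding Eg_def by (rule imageI)
      then have "(g y, g z) \<in> adjacency (Eg \<union> Ep)" by (simp add: adjacency_def)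
      then show ?case using step by (meson rtrancl.rtrancl_into_rtrancl)
    qed simp
    fix u assume "u \<in> V'"
    then consider w where "w \<in> V" "u = g w" | "u \<in> M" by (auto simp: V'_def)
    then show "(g r, u) \<in> (adjacency (Eg \<union> Ep))\<^sup>*"
    proof cases
      case 2
      then have "(g u, u) \<in> adjacency (Eg \<union> Ep)" by (auto simp: adjacency_def Ep_def)
      moreover have "(g r, g u) \<in> (adjacency (Eg \<union> Ep))\<^sup>*" using 2 f(3) by (intro old) auto
      ultimately show ?thesis by (meson rtrancl.rtrancl_into_rtrancl)
    qed (use old in auto)
  qed
  have dist: "\<rho> p q + c \<le> weight_dist V' (Eg \<union> Ep) \<omega>' p q"
    if pq: "p \<in> M" "q \<in> M" "p \<noteq> q" for p q
  proof (rule weight_dist_ge[OF conn'])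
    show "p \<in> V'" "q \<in> V'" using pq by (auto simp: V'_def)
    have pV: "p \<in> V" using pq f(3) by auto
    \<comment> \<open>\<open>\<phi>\<close> is the distance from \<open>p\<close> in the new graph, written in terms of the old graph.\<close>
    define \<phi> where "\<phi> x = (if x = p then 0 else if x \<in> M then weight_dist V E \<omega> p x + c
        else weight_dist V E \<omega> p (k x) + c / 2)" for x
    have \<phi>g: "\<phi> (g u) = weight_dist V E \<omega> p u + c / 2" if "u \<in> V" for u
      using gM[OF that] pq kg[OF that] by (auto simp: \<phi>_def)
    have lip: "\<phi> v \<le> \<phi> u + \<omega>' {u, v}" if uv: "{u, v} \<in> Eg \<union> Ep" for u v
      using uv
    proof
      assume "{u, v} \<in> Eg"
      then obtain e where e: "e \<in> E" "{u, v} = g ` e" by (auto simp: Eg_def)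
      have "u \<in> g ` e" "v \<in> g ` e" using e(2) by auto
      then obtain a b where ab: "a \<in> e" "b \<in> e" "u = g a" "v = g b" by auto
      have "u \<noteq> v" using edge_vertices(3)[OF fin' uv] .
      then have "a \<noteq> b" using ab by auto
      moreover obtain a' b' where "e = {a', b'}" using edge_as_pair[OF f(2) e(1)] by metis
      ultimately have eab: "e = {a, b}" using ab by auto
      have "a \<in> V" "b \<in> V" using eV[OF e(1)] ab by auto
      then show ?thesis
        using weight_dist_edge[OF f(1) f(4), of a b p] e pV \<phi>g \<omega>g[OF e(1)] ab(3,4) eab by simp
    next
      assume "{u, v} \<in> Ep"
      then obtain m where m: "m \<in> M" "{u, v} = {m, g m}" by (auto simp: Ep_def)
      have mV: "m \<in> V" using m f(3) by auto
      have "\<phi> (g m) = weight_dist V E \<omega> p m + c / 2" by (rule \<phi>g[OF mV])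
      moreover have "\<phi> m = (if m = p then 0 else weight_dist V E \<omega> p m + c)"
        using m by (simp add: \<phi>_def)
      moreover have "weight_dist V E \<omega> p p = 0" by (rule weight_dist_self[OF f(1) pV])
      ultimately have "\<bar>\<phi> m - \<phi> (g m)\<bar> \<le> c / 2" using \<open>0 \<le> c\<close> by auto
      moreover have "u = m \<and> v = g m \<or> u = g m \<and> v = m" using m by (auto simp: doubleton_eq_iff)
      moreover have "\<omega>' {u, v} = c / 2" using m(2) \<omega>p[OF m(1)] by simp
      ultimately show ?thesis by auto
    qed
    fix P assume P: "path_between V' (Eg \<union> Ep) p q P"
    then have "\<phi> (last P) \<le> \<phi> (hd P) + path_weight \<omega>' P"
      using lip by (intro potential_le_path_weight[where E = "Eg \<union> Ep"])
        (auto simp: path_between_def)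
    then have "weight_dist V E \<omega> p q + c \<le> path_weight \<omega>' P"
      using P pq by (auto simp: path_between_def \<phi>_def)
    then show "\<rho> p q + c \<le> path_weight \<omega>' P" using f(5)[OF pq(1,2)] by linarith
  qed
  have "filling M (affine_dist 1 \<rho> c) V' (Eg \<union> Ep) \<omega>'"
    unfolding filling_def joins_def
  proof (intro conjI ballI conn')
    show "M \<subseteq> V'" by (simp add: V'_def)
    show "weight_function (Eg \<union> Ep) \<omega>'"
      using \<omega>g f(4) \<open>0 \<le> c\<close> by (simp add: weight_function_def Eg_def Ep_def \<omega>p ball_Un)
    fix p q assume "p \<in> M" "q \<in> M"
    then show "affine_dist 1 \<rho> c p q \<le> weight_dist V' (Eg \<union> Ep) \<omega>' p q"
      using dist weight_dist_self[OF conn', of p \<omega>'] by (auto simp: affine_dist_def V'_def)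
  qed
  moreover have "graph_weight (Eg \<union> Ep) \<omega>' = graph_weight E \<omega> + card M * (c / 2)"
  proof -
    have "Eg \<inter> Ep = {}"
    proof -
      have "e \<inter> M = {}" if "e \<in> Eg" for e using that gM eV by (fastforce simp: Eg_def)
      then show ?thesis by (auto simp: Ep_def)
    qed
    moreover have "finite Eg" "finite Ep"
      using finite_graph_finite_edges[OF f(2)] \<open>finite M\<close> by (auto simp: Eg_def Ep_def)
    ultimately have "graph_weight (Eg \<union> Ep) \<omega>' = sum \<omega>' Eg + sum \<omega>' Ep"
      unfolding graph_weight_def by (intro sum.union_disjoint) auto
    moreover have "sum \<omega>' Eg = sum \<omega> E"
    proof -
      have "inj_on (\<lambda>e. g ` e) E"
        by (rule inj_onI) (metis eV(1) inj inj_on_image_eq_iff)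
      then show ?thesis unfolding Eg_def by (simp add: sum.reindex \<omega>g)
    qed
    moreover have "sum \<omega>' Ep = card M * (c / 2)"
    proof -
      have "inj_on (\<lambda>p. {p, g p}) M"
      proof (rule inj_onI)
        fix p q assume "p \<in> M" "q \<in> M" "{p, g p} = {q, g q}"
        then show "p = q" using gM f(3) by (metis doubleton_eq_iff subsetD)
      qed
      then show ?thesis unfolding Ep_def by (simp add: sum.reindex \<omega>p)
    qed
    ultimately show ?thesis by (simp add: graph_weight_def)
  qed
  ultimately show thesis by (rule that)
qed

section \<open>Shrinking the balls around the points of M\<close>

text \<open>The length that remains, at vertex \<open>u\<close>, of the ball of radius \<open>c / 2\<close> around \<open>r\<close>.\<close>

definition residual_radius ::
  "'v set \<Rightarrow> 'v set set \<Rightarrow> ('v set \<Rightarrow> real) \<Rightarrow> real \<Rightarrow> 'v \<Rightarrow> 'v \<Rightarrow> real" where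
  "residual_radius V E \<omega> c r u = max 0 (c / 2 - weight_dist V E \<omega> r u)"

text \<open>The length of the part of the edge \<open>e\<close>, viewed as a segment of length \<open>\<omega> e\<close>, that lies in
  the ball of radius \<open>c / 2\<close> around \<open>r\<close>.\<close>

definition ball_part ::
  "'v set \<Rightarrow> 'v set set \<Rightarrow> ('v set \<Rightarrow> real) \<Rightarrow> real \<Rightarrow> 'v \<Rightarrow> 'v set \<Rightarrow> real" where
  "ball_part V E \<omega> c r e = min (\<omega> e) (\<Sum>u\<in>e. residual_radius V E \<omega> c r u)"

lemma residual_radius_nonneg: "0 \<le> residual_radius V E \<omega> c r u"
  by (simp add: residual_radius_def)

lemma ball_part_nonneg: "weight_function E \<omega> \<Longrightarrow> e \<in> E \<Longrightarrow> 0 \<le> ball_part V E \<omega> c r e"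
  by (simp add: ball_part_def weight_function_def sum_nonneg residual_radius_nonneg)

lemma ball_part_edge:
  "u \<noteq> v \<Longrightarrow> ball_part V E \<omega> c r {u, v} =
     min (\<omega> {u, v}) (residual_radius V E \<omega> c r u + residual_radius V E \<omega> c r v)"
  by (simp add: ball_part_def)

lemma residual_radius_diff_le_path_weight:
  assumes conn: "connected_graph V E" and wf: "weight_function E \<omega>" and "r \<in> V"
    and "walk E p" and "p \<noteq> []"
  shows "\<bar>residual_radius V E \<omega> c r (hd p) - residual_radius V E \<omega> c r (last p)\<bar>
    \<le> path_weight (ball_part V E \<omega> c r) p"
proof -
  let ?h = "residual_radius V E \<omega> c r"
  have fg: "finite_graph V E" using conn by (simp add: connected_graph_def)
  have lip: "\<bar>?h u - ?h v\<bar> \<le> ball_part V E \<omega> c r {u, v}" if e: "{u, v} \<in> E" for u v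
  proof -
    have "weight_dist V E \<omega> r v \<le> weight_dist V E \<omega> r u + \<omega> {u, v}"
      "weight_dist V E \<omega> r u \<le> weight_dist V E \<omega> r v + \<omega> {u, v}"
      using weight_dist_edge[OF conn wf e \<open>r \<in> V\<close>] weight_dist_edge[OF conn wf _ \<open>r \<in> V\<close>, of v u] e
      by (simp_all add: insert_commute)
    moreover have "0 \<le> \<omega> {u, v}" using wf e by (simp add: weight_function_def)
    ultimately show ?thesis
      unfolding ball_part_edge[OF edge_vertices(3)[OF fg e]] residual_radius_def by linarith
  qed
  have "?h (last p) \<le> ?h (hd p) + path_weight (ball_part V E \<omega> c r) p"
    by (rule potential_le_path_weight[OF _ assms(4,5)]) (use lip in fastforce)
  moreover have "- ?h (last p) \<le> - ?h (hd p) + path_weight (ball_part V E \<omega> c r) p"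
    by (rule potential_le_path_weight[OF _ assms(4,5)]) (use lip in fastforce)
  ultimately show ?thesis by linarith
qed

text \<open>In a filling of \<open>\<rho> + c\<close> the open balls of radius \<open>c / 2\<close> around the points of \<open>M\<close> are
  disjoint. Shrinking each of them to a point gives a filling of \<open>\<rho>\<close>: a path from \<open>p\<close> to \<open>q\<close>
  visiting the balls around \<open>p = r\<^sub>0, r\<^sub>1, \<dots>, r\<^sub>k = q\<close> keeps at least the weight
  \<open>\<rho> r\<^sub>i r\<^sub>i\<^sub>+\<^sub>1\<close> between two successive balls, and the triangle inequality for \<open>\<rho>\<close> applies.
  Instead of contracting the graph, the weight of each edge is reduced by the parts at its two ends
  that lie in balls, and cut off at 0.
  The lost weight is at least the total length of the balls.\<close>

lemma filling_shrink_balls: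
  assumes "finite M" and "M \<noteq> {}" and pm: "pseudo_metric M \<rho>" and "0 \<le> c"
    and fill: "filling M (affine_dist 1 \<rho> c) V E \<omega>"
  obtains \<omega>' where "filling M \<rho> V E \<omega>'"
    "graph_weight E \<omega>' + (\<Sum>r\<in>M. \<Sum>e\<in>E. ball_part V E \<omega> c r e) \<le> graph_weight E \<omega>"
proof -
  note f = fillingD[OF fill]
  let ?D = "weight_dist V E \<omega>" and ?h = "residual_radius V E \<omega> c"
  have sep: "\<rho> r s + c \<le> ?D r s" if "r \<in> M" "s \<in> M" "r \<noteq> s" for r s
    using f(5)[OF that(1,2)] that(3) by (simp add: affine_dist_def)
  have \<rho>_nonneg: "0 \<le> \<rho> r s" if "r \<in> M" "s \<in> M" for r s
    using pm that by (simp add: pseudo_metric_def)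
  have \<rho>_tri: "\<rho> r t \<le> \<rho> r s + \<rho> s t" if "r \<in> M" "s \<in> M" "t \<in> M" for r s t
    using pm that by (simp add: pseudo_metric_def)
  have tri: "?D r s \<le> ?D r u + ?D s u" if "r \<in> M" "s \<in> M" "u \<in> V" for r s u
    using weight_dist_triangle[OF f(1,4)] f(3) that by blast
  have "\<exists>r\<in>M. \<forall>t\<in>M. t \<noteq> r \<longrightarrow> ?h t u = 0" if u: "u \<in> V" for u
  proof (cases "\<exists>r\<in>M. 0 < ?h r u")
    case True
    then obtain r where r: "r \<in> M" "0 < ?h r u" by blast
    have "?h t u = 0" if "t \<in> M" "t \<noteq> r" for t
      using sep[of t r] tri[of t r u] \<rho>_nonneg[of t r] that r u
      by (simp add: residual_radius_def max_def split: if_splits)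
    then show ?thesis using r by blast
  next
    case False
    then have "?h t u = 0" if "t \<in> M" for t
      using that residual_radius_nonneg[of V E \<omega> c t u] by force
    then show ?thesis using \<open>M \<noteq> {}\<close> by blast
  qed
  \<comment> \<open>\<open>n u\<close> is the only point of \<open>M\<close> whose open ball may contain \<open>u\<close>.\<close>
  then obtain n where n: "\<And>u. u \<in> V \<Longrightarrow> n u \<in> M"
    "\<And>u t. u \<in> V \<Longrightarrow> t \<in> M \<Longrightarrow> t \<noteq> n u \<Longrightarrow> ?h t u = 0" by metis
  define g where "g u = ?h (n u) u" for u
  have g_nonneg: "0 \<le> g u" for u by (simp add: g_def residual_radius_nonneg)
  define \<omega>' where "\<omega>' e = max 0 (\<omega> e - (\<Sum>u\<in>e. g u))" for e
  have \<omega>'_edge: "\<omega>' {u, v} = max 0 (\<omega> {u, v} - (g u + g v))" if "{u, v} \<in> E" for u v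
    using edge_vertices(3)[OF f(2) that] by (simp add: \<omega>'_def)
  have less: "\<omega>' e + (\<Sum>r\<in>M. ball_part V E \<omega> c r e) \<le> \<omega> e" if e: "e \<in> E" for e
  proof -
    obtain u v where uv: "e = {u, v}" "u \<noteq> v" using edge_as_pair[OF f(2) e] by metis
    then have V: "u \<in> V" "v \<in> V" using edge_vertices[OF f(2)] e by auto
    have \<omega>0: "0 \<le> \<omega> {u, v}" using f(4) e uv by (simp add: weight_function_def)
    let ?\<tau> = "\<lambda>r. min (\<omega> {u, v}) (?h r u + ?h r v)"
    have "(\<Sum>r\<in>M. ball_part V E \<omega> c r e) = (\<Sum>r\<in>M. ?\<tau> r)"
      using uv by (simp add: ball_part_edge)
    also have "\<dots> = (\<Sum>r\<in>{n u, n v}. ?\<tau> r)"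
    proof (rule sum.mono_neutral_right)
      show "\<forall>r\<in>M - {n u, n v}. ?\<tau> r = 0" using n V \<omega>0 by auto
    qed (use \<open>finite M\<close> n V in auto)
    also have "\<dots> \<le> min (\<omega> {u, v}) (g u + g v)"
    proof (cases "n u = n v")
      case True
      then show ?thesis by (simp add: g_def)
    next
      case False
      have "?h (n u) v = 0" "?h (n v) u = 0" using n V False by auto
      then have "(\<Sum>r\<in>{n u, n v}. ?\<tau> r) = min (\<omega> {u, v}) (g u) + min (\<omega> {u, v}) (g v)"
        using False by (simp add: g_def)
      moreover have "g u + g v \<le> \<omega> {u, v}" if "0 < g u" "0 < g v"
      proof -
        have "g u = c / 2 - ?D (n u) u" "g v = c / 2 - ?D (n v) v"
          using that by (auto simp: g_def residual_radius_def max_def split: if_splits)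
        moreover have "?D (n u) v \<le> ?D (n u) u + \<omega> {u, v}"
          using weight_dist_edge[OF f(1,4)] e uv n(1)[OF V(1)] f(3) by blast
        moreover have "\<rho> (n u) (n v) + c \<le> ?D (n u) (n v)" "0 \<le> \<rho> (n u) (n v)"
          "?D (n u) (n v) \<le> ?D (n u) v + ?D (n v) v"
          using sep \<rho>_nonneg tri n(1) V False by auto
        ultimately show ?thesis by linarith
      qed
      ultimately show ?thesis using g_nonneg[of u] g_nonneg[of v] \<omega>0 by linarith
    qed
    also have "\<dots> = \<omega> e - \<omega>' e" using \<omega>'_edge e uv by (auto simp: max_def min_def)
    finally show ?thesis by linarith
  qed
  have "filling M \<rho> V E \<omega>'"
    unfolding filling_def joins_def
  proof (intro conjI ballI f(1) f(3))
    show "weight_function E \<omega>'" by (simp add: weight_function_def \<omega>'_def)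
    fix p q assume p: "p \<in> M" and q: "q \<in> M"
    show "\<rho> p q \<le> weight_dist V E \<omega>' p q"
    proof (rule weight_dist_ge[OF f(1)])
      show "p \<in> V" "q \<in> V" using p q f(3) by auto
      fix P assume P: "path_between V E p q P"
      \<comment> \<open>\<open>J x u\<close> says that, for some \<open>r\<close> in \<open>M\<close>, the weight \<open>x\<close> pays for the distance \<open>\<rho> p r\<close> and for
        the way from the ball around \<open>r\<close> to \<open>u\<close>. It is preserved along the path.\<close>
      define J where "J x u \<longleftrightarrow> (\<exists>r\<in>M. \<rho> p r \<le> x \<and> \<rho> p r + ?D r u - c / 2 \<le> x)" for x u
      have step: "J (x + \<omega>' {u, v}) v" if e: "{u, v} \<in> E" and J: "J x u" for x u v
      proof -
        have V: "u \<in> V" "v \<in> V" using edge_vertices[OF f(2) e] by auto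
        have nu: "n u \<in> M" and nv: "n v \<in> M" using n V by auto
        have \<omega>': "0 \<le> \<omega>' {u, v}" "\<omega> {u, v} - (g u + g v) \<le> \<omega>' {u, v}"
          using \<omega>'_edge[OF e] by auto
        \<comment> \<open>If \<open>u\<close> lies inside a ball, the centre of that ball can be taken for \<open>r\<close>.\<close>
        obtain r where r: "r \<in> M" "\<rho> p r \<le> x" "\<rho> p r + ?D r u - c / 2 + g u \<le> x"
        proof (cases "0 < g u")
          case True
          then have gu: "g u = c / 2 - ?D (n u) u"
            by (auto simp: g_def residual_radius_def max_def split: if_splits)
          obtain r where r: "r \<in> M" "\<rho> p r \<le> x" "\<rho> p r + ?D r u - c / 2 \<le> x"
            using J by (auto simp: J_def)
          show thesis
          proof (cases "r = n u")
            case False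
            then have "\<rho> p (n u) \<le> x"
              using sep[OF r(1) nu] tri[OF r(1) nu V(1)] \<rho>_tri[OF p r(1) nu] r True gu by linarith
            then show thesis using that[OF nu] gu by simp
          qed (use that r gu in auto)
        next
          case False
          then have "g u = 0" using g_nonneg[of u] by linarith
          then show thesis using J that by (auto simp: J_def)
        qed
        have D: "?D r v \<le> ?D r u + \<omega> {u, v}"
          using weight_dist_edge[OF f(1,4) e] r f(3) by auto
        show ?thesis
        proof (cases "0 < g v")
          case True
          then have gv: "g v = c / 2 - ?D (n v) v"
            by (auto simp: g_def residual_radius_def max_def split: if_splits)
          have "\<rho> p (n v) \<le> x + \<omega>' {u, v}"
          proof (cases "r = n v")
            case True
            then show ?thesis using r \<omega>' by simp
          next
            case False
            then show ?thesis
              using sep[OF r(1) nv] tri[OF r(1) nv V(2)] \<rho>_tri[OF p r(1) nv] r(3) D gv \<omega>'(2)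
              by linarith
          qed
          then show ?thesis unfolding J_def using nv gv True by (intro bexI[of _ "n v"]) auto
        next
          case False
          then have "g v = 0" using g_nonneg[of v] by linarith
          then show ?thesis unfolding J_def using r D \<omega>' by (intro bexI[of _ r]) auto
        qed
      qed
      have "J (0 + path_weight \<omega>' P) (last P)"
      proof (rule walk_invariant[where E = E and J = J and f = \<omega>'])
        have "?D p p = 0" using weight_dist_self[OF f(1)] p f(3) by auto
        then show "J 0 (hd P)"
          unfolding J_def using P p pm \<open>0 \<le> c\<close>
          by (intro bexI[of _ p]) (auto simp: path_between_def pseudo_metric_def)
      qed (use P in \<open>auto simp: path_between_def intro: step\<close>)
      then obtain r where r: "r \<in> M" "\<rho> p r \<le> path_weight \<omega>' P"
        "\<rho> p r + ?D r q - c / 2 \<le> path_weight \<omega>' P"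
        using P by (auto simp: J_def path_between_def)
      show "\<rho> p q \<le> path_weight \<omega>' P"
      proof (cases "r = q")
        case False
        then show ?thesis using sep[OF r(1) q] \<rho>_tri[OF p r(1) q] r \<open>0 \<le> c\<close> by linarith
      qed (use r in simp)
    qed
  qed
  moreover have "graph_weight E \<omega>' + (\<Sum>r\<in>M. \<Sum>e\<in>E. ball_part V E \<omega> c r e) \<le> graph_weight E \<omega>"
    unfolding graph_weight_def
    by (subst sum.swap) (simp add: less sum_mono flip: sum.distrib)
  ultimately show thesis by (rule that)
qed

lemma residual_radius_other:
  assumes "pseudo_metric M \<rho>" and "filling M (affine_dist 1 \<rho> c) V E \<omega>" and "0 \<le> c"
    and "r \<in> M" "q \<in> M" "r \<noteq> q"
  shows "residual_radius V E \<omega> c r q = 0"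
proof -
  have "\<rho> r q + c \<le> weight_dist V E \<omega> r q"
    using fillingD(5)[OF assms(2,4,5)] assms(6) by (simp add: affine_dist_def)
  moreover have "0 \<le> \<rho> r q" using assms by (simp add: pseudo_metric_def)
  ultimately show ?thesis using \<open>0 \<le> c\<close> by (simp add: residual_radius_def)
qed

lemma residual_radius_centre:
  assumes "connected_graph V E" "r \<in> V" "0 \<le> c"
  shows "residual_radius V E \<omega> c r r = c / 2"
  using weight_dist_self[OF assms(1,2)] assms(3) by (simp add: residual_radius_def)

text \<open>Any path from the centre of a ball to another point of \<open>M\<close> leaves the ball.\<close>

lemma ball_length_ge:
  assumes "finite M" and "2 \<le> card M" and pm: "pseudo_metric M \<rho>" and "0 \<le> c"
    and fill: "filling M (affine_dist 1 \<rho> c) V E \<omega>" and r: "r \<in> M"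
  shows "c / 2 \<le> (\<Sum>e\<in>E. ball_part V E \<omega> c r e)"
proof -
  note f = fillingD[OF fill]
  have "M \<noteq> {r}" using assms(2) by auto
  then obtain q where q: "q \<in> M" "q \<noteq> r" using r by blast
  obtain p where p: "path_between V E r q p"
    using f(1,3) r q unfolding connected_graph_def by blast
  have "\<bar>residual_radius V E \<omega> c r (hd p) - residual_radius V E \<omega> c r (last p)\<bar>
      \<le> path_weight (ball_part V E \<omega> c r) p"
    using p r f(3)
    by (intro residual_radius_diff_le_path_weight[OF f(1,4)]) (auto simp: path_between_def)
  moreover have "path_weight (ball_part V E \<omega> c r) p \<le> (\<Sum>e\<in>E. ball_part V E \<omega> c r e)"
    using p ball_part_nonneg[OF f(4)]
    by (intro path_weight_le_sum finite_graph_finite_edges[OF f(2)]) (auto simp: path_between_def)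
  moreover have "residual_radius V E \<omega> c r q = 0"
    using residual_radius_other[OF pm fill \<open>0 \<le> c\<close> r q(1)] q(2) by metis
  moreover have "residual_radius V E \<omega> c r r = c / 2"
    using residual_radius_centre[OF f(1)] r f(3) \<open>0 \<le> c\<close> by auto
  ultimately show ?thesis using p by (simp add: path_between_def)
qed

text \<open>Shrinking the balls and then hanging pendant edges of weight \<open>c / 2\<close> at their centres gives
  another filling of \<open>\<rho> + c\<close>. So in a minimal filling a ball is no longer than a pendant edge.\<close>

lemma minimal_filling_ball_length_le:
  fixes M :: "('v::infinite) set"
  assumes "finite M" and "2 \<le> card M" and pm: "pseudo_metric M \<rho>" and "0 \<le> c"
    and min: "minimal_filling M (affine_dist 1 \<rho> c) V E \<omega>" and r: "r \<in> M"
  shows "(\<Sum>e\<in>E. ball_part V E \<omega> c r e) \<le> c / 2"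
proof -
  have fill: "filling M (affine_dist 1 \<rho> c) V E \<omega>" using min by (simp add: minimal_filling_def)
  let ?B = "\<lambda>s. \<Sum>e\<in>E. ball_part V E \<omega> c s e"
  obtain \<omega>' where \<omega>': "filling M \<rho> V E \<omega>'" "graph_weight E \<omega>' + sum ?B M \<le> graph_weight E \<omega>"
    using filling_shrink_balls[OF \<open>finite M\<close> _ pm \<open>0 \<le> c\<close> fill] r by blast
  obtain V'' E'' \<omega>'' where "filling M (affine_dist 1 \<rho> c) V'' E'' \<omega>''"
    "graph_weight E'' \<omega>'' = graph_weight E \<omega>' + card M * (c / 2)"
    using filling_add_pendants[OF \<open>finite M\<close> \<open>0 \<le> c\<close> \<omega>'(1)] by blast
  then have "graph_weight E \<omega> \<le> graph_weight E \<omega>' + card M * (c / 2)"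
    using min by (metis minimal_filling_def)
  then have *: "sum ?B M \<le> card M * (c / 2)" using \<omega>'(2) by linarith
  then have "?B r + sum ?B (M - {r}) \<le> card M * (c / 2)"
    using sum.remove[OF \<open>finite M\<close> r, of ?B] by simp
  moreover have "sum (\<lambda>_. c / 2) (M - {r}) \<le> sum ?B (M - {r})"
    by (intro sum_mono ball_length_ge[OF assms(1-4) fill]) auto
  moreover have "real (card M) * (c / 2) = c / 2 + sum (\<lambda>_. c / 2) (M - {r})"
  proof -
    have "(\<Sum>_\<in>M. c / 2) = c / 2 + (\<Sum>_\<in>M - {r}. c / 2)"
      using r \<open>finite M\<close> by (rule sum.remove[rotated])
    then show ?thesis by simp
  qed
  ultimately show ?thesis by linarith
qed

section \<open>Paths in trees\<close>

lemma path_between_rev: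
  assumes "path_between V E u v p"
  shows "path_between V E v u (rev p)"
proof -
  have "successively (\<lambda>x y. {y, x} \<in> E) p"
    using assms by (simp add: path_between_def insert_commute)
  then have "walk E (rev p)" by (simp add: successively_rev)
  then show ?thesis using assms by (auto simp: path_between_def hd_rev last_rev)
qed

lemma ex_other_edge:
  assumes "finite_graph V E" and "{x, y} \<in> E" and "vertex_degree E x \<noteq> 1"
  obtains z where "{x, z} \<in> E" "z \<noteq> y"
proof -
  have "{e \<in> E. x \<in> e} \<noteq> {{x, y}}"
    using assms(3) unfolding vertex_degree_def by (metis One_nat_def card_1_singleton_iff)
  then obtain e where e: "e \<in> E" "x \<in> e" "e \<noteq> {x, y}" using assms(2) by blast
  then obtain z where "e = {x, z}" using incident_edge[OF assms(1)] by metis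
  then show thesis using that e by blast
qed

lemma tree_path_snoc:
  assumes tree: "tree_graph V E" and p: "path_between V E u x p" and "2 \<le> length p"
    and "vertex_degree E x \<noteq> 1"
  obtains z where "path_between V E u z (p @ [z])"
proof -
  have fg: "finite_graph V E" using tree by (simp add: tree_graph_def connected_graph_def)
  have "p \<noteq> []" "last p = x" using p by (auto simp: path_between_def)
  then obtain p1 where p1: "p = p1 @ [x]" by (metis append_butlast_last_id)
  then have "p1 \<noteq> []" using assms(3) by auto
  then obtain p' y where p': "p = p' @ [y, x]" using p1
    by (metis append.assoc append_Cons append_Nil append_butlast_last_id)
  have "{x, y} \<in> E"
    using p p' by (simp add: path_between_def successively_append_iff insert_commute)
  then obtain z where z: "{x, z} \<in> E" "z \<noteq> y" using ex_other_edge[OF fg _ assms(4)] by metis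
  have zV: "z \<in> V" "z \<noteq> x" using edge_vertices[OF fg z(1)] by auto
  show thesis
  proof (cases "z \<in> set p")
    case False
    then have "path_between V E u z (p @ [z])"
      using p z zV by (auto simp: path_between_def successively_append_iff)
    then show thesis by (rule that)
  next
    case True
    then obtain a b where ab: "p = a @ z # b" by (meson split_list)
    \<comment> \<open>The part of \<open>p\<close> from \<open>z\<close> on, closed by the edge from \<open>x\<close> to \<open>z\<close>, is a cycle.\<close>
    have "path_between V E z x (z # b)"
      using p ab by (auto simp: path_between_def successively_append_iff)
    moreover have "3 \<le> length (z # b)"
    proof -
      have "b \<noteq> []" using ab p zV by (auto simp: path_between_def)
      moreover have "b \<noteq> [x]" using ab p' z by auto
      moreover have "last b = x" using ab p \<open>b \<noteq> []\<close> by (simp add: path_between_def)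
      ultimately show ?thesis by (cases b rule: remdups_adj.cases) auto
    qed
    ultimately have "graph_cycle V E (z # b)" using z by (auto simp: graph_cycle_def path_between_def)
    then show thesis using tree by (simp add: tree_graph_def)
  qed
qed

lemma tree_path_extend_to_leaves:
  assumes tree: "tree_graph V E" and p: "path_between V E u v p" and "2 \<le> length p"
  obtains xs ys u' v' where "path_between V E u' v' (xs @ p @ ys)"
    "vertex_degree E u' = 1" "vertex_degree E v' = 1"
proof -
  \<comment> \<open>A longest path that contains \<open>p\<close> as a contiguous part ends in leaves on both sides.\<close>
  define Q where "Q q \<longleftrightarrow> (\<exists>xs ys u' v'. q = xs @ p @ ys \<and> path_between V E u' v' q)" for q
  have fV: "finite V" using tree by (simp add: tree_graph_def connected_graph_def finite_graph_def)
  have "Q p" unfolding Q_def using p by (metis append_Nil append_Nil2)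
  moreover have "length q \<le> card V" if "Q q" for q
  proof -
    have "distinct q" "set q \<subseteq> V" using that by (auto simp: Q_def path_between_def)
    then show ?thesis using card_mono[OF fV] distinct_card by metis
  qed
  ultimately obtain q where q: "Q q" "\<And>q'. Q q' \<Longrightarrow> length q' \<le> length q"
    using ex_has_greatest_nat[of Q p length "Suc (card V)"] by (auto simp: le_imp_less_Suc)
  then obtain xs ys u' v' where xy: "q = xs @ p @ ys" "path_between V E u' v' q"
    by (auto simp: Q_def)
  have len: "2 \<le> length q" using xy assms(3) by simp
  have "vertex_degree E v' = 1"
  proof (rule ccontr)
    assume "\<not> ?thesis"
    then obtain z where "path_between V E u' z (q @ [z])"
      using tree_path_snoc[OF tree xy(2) len] by blast
    then have "Q (q @ [z])" unfolding Q_def using xy(1) by (metis append.assoc)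
    then show False using q(2) by fastforce
  qed
  moreover have "vertex_degree E u' = 1"
  proof (rule ccontr)
    assume "\<not> ?thesis"
    then obtain z where "path_between V E v' z (rev q @ [z])"
      using tree_path_snoc[OF tree path_between_rev[OF xy(2)]] len by auto
    then have "path_between V E z v' (z # q)" using path_between_rev by fastforce
    then have "Q (z # q)" unfolding Q_def using xy(1) by (metis append_Cons)
    then show False using q(2) by fastforce
  qed
  ultimately show thesis using that xy by blast
qed

lemma tree_two_branches:
  assumes tree: "tree_graph V E"
    and leaves: "\<And>x. x \<in> V \<Longrightarrow> vertex_degree E x = 1 \<Longrightarrow> x \<in> M"
    and e: "{v, a} \<in> E" "{v, b} \<in> E" "a \<noteq> b"
  obtains xs ys where "path_between V E (hd (xs @ [v])) (last (v # ys)) (xs @ v # ys)"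
    "xs \<noteq> []" "ys \<noteq> []" "last xs = a" "hd ys = b" "hd xs \<in> M" "last ys \<in> M"
proof -
  have fg: "finite_graph V E" using tree by (simp add: tree_graph_def connected_graph_def)
  have "path_between V E a b [a, v, b]"
    using e edge_vertices[OF fg e(1)] edge_vertices[OF fg e(2)]
    by (auto simp: path_between_def insert_commute)
  then obtain xs ys u' v' where P: "path_between V E u' v' (xs @ [a, v, b] @ ys)"
    "vertex_degree E u' = 1" "vertex_degree E v' = 1"
    by (rule tree_path_extend_to_leaves[OF tree]) auto
  have hl: "hd (xs @ [a]) = u'" "last (b # ys) = v'" 
    using P(1) by (auto simp: path_between_def hd_append split: if_splits)
  have "u' \<in> set (xs @ [a])" "v' \<in> set (b # ys)"
    using hl by (metis hd_in_set snoc_eq_iff_butlast, metis last_in_set list.distinct(1))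
  then have "u' \<in> V" "v' \<in> V" using P(1) unfolding path_between_def by auto
  then have M: "u' \<in> M" "v' \<in> M" using leaves P(2,3) by auto
  show thesis
    by (rule that[of "xs @ [a]" "b # ys"])
       (use P hl M in \<open>auto simp: path_between_def hd_append\<close>)
qed

section \<open>Boundary edges of minimal fillings\<close>

text \<open>A path through \<open>v\<close> both of whose ends are points of \<open>M\<close> other than \<open>r\<close> leaves the ball
  around \<open>r\<close> in both directions.\<close>

lemma two_branches_ball_length:
  assumes pm: "pseudo_metric M \<rho>" and fill: "filling M (affine_dist 1 \<rho> c) V E \<omega>" and "0 \<le> c"
    and r: "r \<in> M" and F: "F \<subseteq> E"
    and P: "distinct (xs @ v # ys)" "walk F (xs @ v # ys)"
    and ends: "xs \<noteq> []" "ys \<noteq> []" "hd xs \<in> M - {r}" "last ys \<in> M - {r}"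
  shows "2 * residual_radius V E \<omega> c r v \<le> (\<Sum>e\<in>F. ball_part V E \<omega> c r e)"
proof -
  note f = fillingD[OF fill]
  let ?h = "residual_radius V E \<omega> c r" and ?\<tau> = "ball_part V E \<omega> c r"
  have rV: "r \<in> V" using r f(3) by auto
  have wE: "walk E (xs @ v # ys)" using F by (intro successively_mono[OF P(2)]) auto
  then have "walk E (xs @ [v])" "walk E (v # ys)"
    by (auto simp: successively_append_iff successively_Cons)
  note diff = this[THEN residual_radius_diff_le_path_weight[OF f(1,4) rV]]
  have "?h (hd xs) = 0" "?h (last ys) = 0"
    using residual_radius_other[OF pm fill \<open>0 \<le> c\<close> r] ends by auto
  then have "?h v \<le> path_weight ?\<tau> (xs @ [v])" "?h v \<le> path_weight ?\<tau> (v # ys)"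
    using diff[of c] ends by auto
  moreover have "path_weight ?\<tau> (xs @ v # ys) \<le> sum ?\<tau> F"
    using ball_part_nonneg[OF f(4)] F finite_graph_finite_edges[OF f(2)]
    by (intro path_weight_le_sum P) (auto intro: finite_subset)
  ultimately show ?thesis using path_weight_split[of ?\<tau> xs v ys] by linarith
qed

text \<open>Around a point of \<open>M\<close> with two branches the ball would have length at least \<open>c\<close>, twice that
  of a pendant edge.\<close>

lemma minimal_filling_degree_eq_1:
  fixes M :: "('v::infinite) set"
  assumes "finite M" and "2 \<le> card M" and pm: "pseudo_metric M \<rho>" and "0 < c"
    and min: "minimal_filling M (affine_dist 1 \<rho> c) V E \<omega>" and tree: "tree_graph V E"
    and leaves: "\<And>x. x \<in> V \<Longrightarrow> vertex_degree E x = 1 \<Longrightarrow> x \<in> M" and v: "v \<in> M"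
  shows "vertex_degree E v = 1"
proof (rule ccontr)
  assume deg: "vertex_degree E v \<noteq> 1"
  have fill: "filling M (affine_dist 1 \<rho> c) V E \<omega>" using min by (simp add: minimal_filling_def)
  note f = fillingD[OF fill]
  have "M \<noteq> {v}" using assms(2) by auto
  then obtain q where "q \<in> M" "q \<noteq> v" using v by blast
  then obtain a where a: "{v, a} \<in> E" using ex_edge_at_vertex[OF f(1), of v q] v f(3) by blast
  then obtain b where b: "{v, b} \<in> E" "b \<noteq> a" using ex_other_edge[OF f(2) _ deg] by metis
  obtain xs ys where P: "path_between V E (hd (xs @ [v])) (last (v # ys)) (xs @ v # ys)"
    "xs \<noteq> []" "ys \<noteq> []" "hd xs \<in> M" "last ys \<in> M"
    using tree_two_branches[OF tree leaves a b(1) b(2)[symmetric]] by metis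
  have "distinct (xs @ v # ys)" "walk E (xs @ v # ys)" using P(1) by (auto simp: path_between_def)
  moreover have "hd xs \<noteq> v" "last ys \<noteq> v"
    using \<open>distinct (xs @ v # ys)\<close> P(2,3) hd_in_set[of xs] last_in_set[of ys] by auto
  ultimately have "2 * residual_radius V E \<omega> c v v \<le> (\<Sum>e\<in>E. ball_part V E \<omega> c v e)"
    using P \<open>0 < c\<close> by (intro two_branches_ball_length[OF pm fill _ v]) auto
  moreover have "residual_radius V E \<omega> c v v = c / 2"
    using residual_radius_centre[OF f(1)] v f(3) \<open>0 < c\<close> by auto
  ultimately show False
    using minimal_filling_ball_length_le[OF assms(1,2) pm _ min v] \<open>0 < c\<close> by auto
qed

lemma leaf_not_on_path:
  assumes fg: "finite_graph V E" and p: "vertex_degree E p = 1" "{p, w} \<in> E"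
    and P: "distinct (xs @ w # ys)" "walk E (xs @ w # ys)"
    and ne: "xs \<noteq> [] \<Longrightarrow> last xs \<noteq> p" "ys \<noteq> [] \<Longrightarrow> hd ys \<noteq> p"
  shows "p \<notin> set (xs @ w # ys)"
proof
  note nbr = leaf_unique_neighbour[OF p(1) _ p(2)]
  assume "p \<in> set (xs @ w # ys)"
  moreover have "p \<noteq> w" using edge_vertices(3)[OF fg p(2)] .
  ultimately consider "p \<in> set xs" | "p \<in> set ys" by auto
  then show False
  proof cases
    case 1
    then obtain a b where ab: "xs = a @ p # b" by (meson split_list)
    show False
    proof (cases b)
      case Nil
      then show False using ne ab by simp
    next
      case (Cons x b')
      then have "{p, x} \<in> E" using P(2) ab by (simp add: successively_append_iff)
      then show False using nbr P(1) ab Cons by auto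
    qed
  next
    case 2
    then obtain a b where ab: "ys = a @ p # b" by (meson split_list)
    show False
    proof (cases a rule: rev_cases)
      case Nil
      then show False using ne ab by simp
    next
      case (snoc a' x)
      then have "{p, x} \<in> E" using P(2) ab
        by (simp add: successively_append_iff successively_Cons insert_commute)
      then show False using nbr P(1) ab snoc by auto
    qed
  qed
qed

text \<open>If the edge at the leaf \<open>p\<close> were shorter than \<open>c / 2\<close>, the ball around \<open>p\<close> would branch at
  its other end and be longer than a pendant edge.\<close>

lemma minimal_filling_boundary_edge_ge:
  fixes M :: "('v::infinite) set"
  assumes "finite M" and "2 \<le> card M" and pm: "pseudo_metric M \<rho>" and "0 \<le> c"
    and min: "minimal_filling M (affine_dist 1 \<rho> c) V E \<omega>" and tree: "tree_graph V E"
    and deg2: "\<forall>v\<in>V. vertex_degree E v = 2 \<longrightarrow> v \<in> M"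
    and M: "M = {v \<in> V. vertex_degree E v = 1}"
    and e: "e \<in> boundary_edges M E"
  shows "c / 2 \<le> \<omega> e"
proof -
  have fill: "filling M (affine_dist 1 \<rho> c) V E \<omega>" using min by (simp add: minimal_filling_def)
  note f = fillingD[OF fill]
  obtain p where p: "p \<in> M" "p \<in> e" and eE: "e \<in> E" using e by (auto simp: boundary_edges_def)
  obtain w where w: "e = {p, w}" using incident_edge[OF f(2) eE p(2)] by blast
  then have pw: "{p, w} \<in> E" using eE by simp
  note V = edge_vertices[OF f(2) pw]
  have pdeg: "vertex_degree E p = 1" using p(1) M by blast
  have D: "weight_dist V E \<omega> p w \<le> \<omega> e"
    using weight_dist_edge[OF f(1,4) pw V(1)] weight_dist_self[OF f(1) V(1)] w by simp
  show ?thesis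
  proof (cases "w \<in> M")
    case True
    then have "\<rho> p w + c \<le> \<omega> e" "0 \<le> \<rho> p w"
      using f(5)[OF p(1) True] V(3) D pm p by (auto simp: affine_dist_def pseudo_metric_def)
    then show ?thesis using \<open>0 \<le> c\<close> by linarith
  next
    case False
    show ?thesis
    proof (rule ccontr)
      assume short: "\<not> ?thesis"
      let ?W = "{e' \<in> E. w \<in> e'}"
      have finE: "finite E" by (rule finite_graph_finite_edges[OF f(2)])
      then have finW: "finite ?W" by simp
      have "vertex_degree E w \<noteq> 1" "vertex_degree E w \<noteq> 2" using False M deg2 V(2) by blast+
      then have "card ?W \<noteq> 1" "card ?W \<noteq> 2" by (simp_all add: vertex_degree_def)
      moreover have "e \<in> ?W" using w eE by simp
      ultimately have "\<not> card (?W - {e}) \<le> Suc 0"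
        using card.remove[OF finW, of e] by linarith
      then obtain e1 e2 where e12: "e1 \<in> ?W - {e}" "e2 \<in> ?W - {e}" "e1 \<noteq> e2"
        using card_le_Suc0_iff_eq[of "?W - {e}"] finite_Diff[OF finW] by blast
      have "e1 \<in> E" "w \<in> e1" "e2 \<in> E" "w \<in> e2" using e12 by auto
      then obtain a b where ab: "e1 = {w, a}" "e2 = {w, b}"
        using incident_edge[OF f(2)] by metis
      then have ab': "{w, a} \<in> E" "{w, b} \<in> E" "a \<noteq> b" "a \<noteq> p" "b \<noteq> p"
        using e12 w by (auto simp: insert_commute)
      obtain xs ys where P: "path_between V E (hd (xs @ [w])) (last (w # ys)) (xs @ w # ys)"
        "xs \<noteq> []" "ys \<noteq> []" "last xs = a" "hd ys = b" "hd xs \<in> M" "last ys \<in> M"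
        using tree_two_branches[OF tree, of M w a b] ab' M by blast
      then have dP: "distinct (xs @ w # ys)" "walk E (xs @ w # ys)"
        by (auto simp: path_between_def)
      have p_notin: "p \<notin> set (xs @ w # ys)"
        using pdeg pw dP ab' P by (intro leaf_not_on_path[OF f(2)]) auto
      have "successively (\<lambda>x y. {x, y} \<in> E - {e}) (xs @ w # ys)"
        by (rule successively_cong[THEN iffD1, OF _ refl dP(2)]) (use p_notin w in auto)
      moreover have "hd xs \<in> M - {p}" "last ys \<in> M - {p}"
        using P hd_in_set[of xs] last_in_set[of ys] p_notin by auto
      ultimately have "2 * residual_radius V E \<omega> c p w \<le> (\<Sum>e'\<in>E - {e}. ball_part V E \<omega> c p e')"
        using P(2,3) by (intro two_branches_ball_length[OF pm fill \<open>0 \<le> c\<close> p(1) Diff_subset dP(1)])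
      moreover have "(\<Sum>e'\<in>E. ball_part V E \<omega> c p e') =
          ball_part V E \<omega> c p e + (\<Sum>e'\<in>E - {e}. ball_part V E \<omega> c p e')"
        using finE eE by (rule sum.remove)
      moreover have "ball_part V E \<omega> c p e =
          min (\<omega> e) (c / 2 + residual_radius V E \<omega> c p w)"
        unfolding w ball_part_edge[OF V(3)] residual_radius_centre[OF f(1) V(1) \<open>0 \<le> c\<close>] ..
      moreover have "c / 2 - \<omega> e \<le> residual_radius V E \<omega> c p w"
        using D by (simp add: residual_radius_def)
      moreover have "(\<Sum>e'\<in>E. ball_part V E \<omega> c p e') \<le> c / 2"
        by (rule minimal_filling_ball_length_le[OF assms(1,2) pm \<open>0 \<le> c\<close> min p(1)])
      ultimately show False using short by linarith
    qed
  qed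
qed

lemma tree_leaves_card_ge_2:
  assumes "finite M" and "M \<noteq> {}" and tree: "tree_graph V E"
    and M: "M = {v \<in> V. vertex_degree E v = 1}"
  shows "2 \<le> card M" and "boundary_edges M E \<noteq> {}"
proof -
  have fg: "finite_graph V E" using tree by (simp add: tree_graph_def connected_graph_def)
  obtain p where p: "p \<in> M" using assms(2) by blast
  then have "vertex_degree E p = 1" using M by blast
  then obtain w where w: "{p, w} \<in> E" using leaf_edge[OF fg] by blast
  then show "boundary_edges M E \<noteq> {}" using p by (auto simp: boundary_edges_def)
  have "path_between V E p w [p, w]"
    using w edge_vertices[OF fg w] by (auto simp: path_between_def)
  then obtain xs ys u v where P: "path_between V E u v (xs @ [p, w] @ ys)"
    "vertex_degree E u = 1" "vertex_degree E v = 1"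
    by (rule tree_path_extend_to_leaves[OF tree]) auto
  obtain x zs where zs: "xs @ [p, w] @ ys = x # zs" "zs \<noteq> []" by (cases xs) auto
  then have "u = x" "v = last zs" "x \<notin> set zs" "set (x # zs) \<subseteq> V"
    using P(1) by (auto simp: path_between_def)
  then have "u \<noteq> v" "u \<in> V" "v \<in> V" using last_in_set[OF zs(2)] by auto
  then have "{u, v} \<subseteq> M" using M P by auto
  then have "card {u, v} \<le> card M" using \<open>finite M\<close> by (intro card_mono)
  then show "2 \<le> card M" using \<open>u \<noteq> v\<close> by simp
qed

section \<open>Shifting the metric\<close>

lemma pseudo_metric_shift:
  assumes "pseudo_metric M \<rho>" and "0 \<le> c"
  shows "pseudo_metric M (affine_dist 1 \<rho> c)"
proof -
  have "affine_dist 1 \<rho> c x z \<le> affine_dist 1 \<rho> c x y + affine_dist 1 \<rho> c y z"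
    if "x \<in> M" "y \<in> M" "z \<in> M" for x y z
  proof -
    have "\<rho> x z \<le> \<rho> x y + \<rho> y z" "0 \<le> \<rho> x y" "0 \<le> \<rho> y z" "\<rho> x x = 0" "\<rho> y y = 0"
      using assms(1) that by (simp_all add: pseudo_metric_def)
    then show ?thesis using \<open>0 \<le> c\<close> by (auto simp: affine_dist_def)
  qed
  then show ?thesis
    unfolding pseudo_metric_def using assms by (auto simp: affine_dist_def pseudo_metric_def)
qed

lemma affine_dist_shift_back:
  assumes "pseudo_metric M \<rho>" and "x \<in> M"
  shows "affine_dist 1 (affine_dist 1 \<rho> a) (- a) x y = \<rho> x y"
  using assms by (auto simp: affine_dist_def pseudo_metric_def)

text \<open>Only connectivity of the graph matters here, not that it is a tree.\<close>

context
  fixes M V :: "'v set" and E :: "'v set set"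
  assumes conn: "connected_graph V E" and fin: "finite M" and card: "3 \<le> card M" and MV: "M \<subseteq> V"
    and leaf: "\<And>v. v \<in> V \<Longrightarrow> v \<in> M \<longleftrightarrow> vertex_degree E v = 1"
begin

lemma leaf_unique_edge:
  assumes "p \<in> M" "{p, x} \<in> E" "{p, y} \<in> E"
  shows "x = y"
  using leaf_unique_neighbour[OF _ assms(2,3)] leaf assms(1) MV by blast

text \<open>Two adjacent leaves would form a connected component with only two points.\<close>

lemma no_edge_between_leaves:
  assumes "p \<in> M" "q \<in> M"
  shows "{p, q} \<notin> E"
proof
  assume pq: "{p, q} \<in> E"
  have "\<not> M \<subseteq> {p, q}" using card card_mono[of "{p, q}" M] card_2_iff[of "{p, q}"]
    by (cases "p = q") auto
  then obtain r where r: "r \<in> M" "r \<notin> {p, q}" by blast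
  have "(p, r) \<in> (adjacency E)\<^sup>*" using connected_graphD[OF conn] assms r MV by blast
  then have "r \<in> {p, q}"
  proof (induction rule: rtrancl_induct)
    case (step y z)
    then have "{y, z} \<in> E" by (simp add: adjacency_def)
    moreover have "{q, p} \<in> E" using pq by (simp add: insert_commute)
    ultimately show ?case using step.IH leaf_unique_edge assms pq by blast
  qed simp
  then show False using r by simp
qed

lemma card_boundary_edges: "card (boundary_edges M E) = card M"
proof -
  have fg: "finite_graph V E" using conn by (simp add: connected_graph_def)
  have "\<exists>w. {p, w} \<in> E" if p: "p \<in> M" for p
    using leaf_edge[OF fg, of p] leaf p MV by blast
  then obtain w where w: "\<And>p. p \<in> M \<Longrightarrow> {p, w p} \<in> E" by metis
  have wM: "w p \<notin> M" if "p \<in> M" for p using no_edge_between_leaves w that by blast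
  have "bij_betw (\<lambda>p. {p, w p}) M (boundary_edges M E)"
    unfolding bij_betw_def
  proof
    show "inj_on (\<lambda>p. {p, w p}) M"
      by (rule inj_onI) (metis wM doubleton_eq_iff)
    show "(\<lambda>p. {p, w p}) ` M = boundary_edges M E"
    proof
      show "(\<lambda>p. {p, w p}) ` M \<subseteq> boundary_edges M E" using w by (auto simp: boundary_edges_def)
      show "boundary_edges M E \<subseteq> (\<lambda>p. {p, w p}) ` M"
      proof
        fix e assume "e \<in> boundary_edges M E"
        then obtain p where p: "e \<in> E" "p \<in> e" "p \<in> M" by (auto simp: boundary_edges_def)
        then obtain x where x: "e = {p, x}" using incident_edge[OF fg p(1,2)] by blast
        then have "x = w p" using leaf_unique_edge[OF p(3)] w[OF p(3)] p(1) by blast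
        then show "e \<in> (\<lambda>p. {p, w p}) ` M" using x p by blast
      qed
    qed
  qed
  then show ?thesis by (metis bij_betw_same_card)
qed

lemma graph_weight_shifted:
  "graph_weight E (shifted_weight M E \<omega> a) = graph_weight E \<omega> + card M * (a / 2)"
proof -
  have finE: "finite E"
    using finite_graph_finite_edges conn by (auto simp: connected_graph_def)
  have "graph_weight E (shifted_weight M E \<omega> a) =
      (\<Sum>e\<in>E. \<omega> e + (if e \<in> boundary_edges M E then a / 2 else 0))"
    unfolding graph_weight_def by (intro sum.cong) (auto simp: shifted_weight_def)
  also have "\<dots> = graph_weight E \<omega> + (\<Sum>e\<in>E \<inter> boundary_edges M E. a / 2)"
    using finE by (simp only: graph_weight_def sum.distrib sum.inter_restrict)
  also have "E \<inter> boundary_edges M E = boundary_edges M E" by (auto simp: boundary_edges_def)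
  finally show ?thesis by (simp add: card_boundary_edges)
qed

text \<open>A path between two leaves contains exactly two boundary edges, its first and its last.\<close>

lemma path_weight_shifted:
  assumes p: "p \<in> M" and q: "q \<in> M" and "p \<noteq> q" and P: "path_between V E p q P"
  shows "path_weight (shifted_weight M E \<omega> a) P = path_weight \<omega> P + a"
proof -
  let ?\<omega>' = "shifted_weight M E \<omega> a"
  obtain R' where R': "P = p # R'" using P by (cases P) (auto simp: path_between_def)
  moreover have "R' \<noteq> []" "last R' = q" using R' P \<open>p \<noteq> q\<close> by (auto simp: path_between_def split: if_splits)
  ultimately obtain R where R: "P = p # R @ [q]" by (metis append_butlast_last_id)
  have R_ne: "R \<noteq> []" using R P no_edge_between_leaves[OF p q] by (auto simp: path_between_def)
  have inner: "x \<notin> M" if x: "x \<in> set R" for x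
  proof
    assume xM: "x \<in> M"
    obtain r1 r2 where r: "R = r1 @ x # r2" using split_list[OF x] by blast
    have dw: "distinct ((p # r1) @ x # (r2 @ [q]))" "walk E ((p # r1) @ x # (r2 @ [q]))"
      using P R r by (auto simp: path_between_def)
    have "{last (p # r1), x} \<in> E" "{x, hd (r2 @ [q])} \<in> E"
      using dw(2) by (auto simp: successively_append_iff successively_Cons hd_append)
    then have "last (p # r1) = hd (r2 @ [q])"
      by (intro leaf_unique_edge[OF xM]) (simp_all only: insert_commute)
    moreover have "last (p # r1) \<in> set (p # r1)" "hd (r2 @ [q]) \<in> set (r2 @ [q])"
      by (rule last_in_set, simp, rule hd_in_set, simp)
    ultimately show False using dw(1) by auto
  qed
  have wR: "walk E R" "{p, hd R} \<in> E" "{last R, q} \<in> E"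
    using P R R_ne by (auto simp: path_between_def successively_append_iff successively_Cons)
  have split: "path_weight f P = f {p, hd R} + path_weight f R + f {last R, q}" for f
  proof -
    have "path_weight f P = f {p, hd R} + path_weight f (R @ [q])"
      using R R_ne by (cases R) auto
    also have "R @ [q] = butlast R @ last R # [q]" using R_ne by simp
    also have "path_weight f \<dots> = path_weight f R + f {last R, q}"
      using path_weight_split[of f "butlast R" "last R" "[q]"] R_ne by simp
    finally show ?thesis by simp
  qed
  have "path_weight ?\<omega>' R = path_weight \<omega> R"
    using inner by (intro path_weight_cong[OF _ wR(1)])
      (auto simp: shifted_weight_def boundary_edges_def)
  moreover have "?\<omega>' {p, hd R} = \<omega> {p, hd R} + a / 2" "?\<omega>' {last R, q} = \<omega> {last R, q} + a / 2"
    using wR p q by (auto simp: shifted_weight_def boundary_edges_def)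
  ultimately show ?thesis by (simp add: split)
qed

lemma filling_shifted:
  assumes fill: "filling M \<rho> V E \<omega>" and wf: "weight_function E (shifted_weight M E \<omega> a)"
  shows "filling M (affine_dist 1 \<rho> a) V E (shifted_weight M E \<omega> a)"
  unfolding filling_def joins_def
proof (intro conjI ballI conn MV wf)
  fix p q assume pq: "p \<in> M" "q \<in> M"
  show "affine_dist 1 \<rho> a p q \<le> weight_dist V E (shifted_weight M E \<omega> a) p q"
  proof (cases "p = q")
    case True
    then show ?thesis using weight_dist_self[OF conn] pq MV by (auto simp: affine_dist_def)
  next
    case False
    show ?thesis
    proof (rule weight_dist_ge[OF conn])
      fix P assume P: "path_between V E p q P"
      have "\<rho> p q \<le> path_weight \<omega> P"
        using fillingD(5)[OF fill pq] weight_dist_le[OF conn P, of \<omega>] by linarith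
      then show "affine_dist 1 \<rho> a p q \<le> path_weight (shifted_weight M E \<omega> a) P"
        using path_weight_shifted[OF pq False P] False by (simp add: affine_dist_def)
    qed (use pq MV in auto)
  qed
qed

end

lemma shifted_weight_nonneg:
  fixes M :: "('v::infinite) set"
  assumes "finite M" and "2 \<le> card M" and pm: "pseudo_metric M \<rho>"
    and pma: "pseudo_metric M (affine_dist 1 \<rho> a)"
    and min: "minimal_filling M \<rho> V E \<omega>" and tree: "tree_graph V E"
    and deg2: "\<forall>v\<in>V. vertex_degree E v = 2 \<longrightarrow> v \<in> M"
    and M: "M = {v \<in> V. vertex_degree E v = 1}"
  shows "weight_function E (shifted_weight M E \<omega> a)"
proof -
  have wf: "weight_function E \<omega>" using min by (simp add: minimal_filling_def filling_def)
  have "0 \<le> \<omega> e + a / 2" if e: "e \<in> boundary_edges M E" for e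
  proof (cases "0 \<le> a")
    case True
    then show ?thesis using wf e by (auto simp: weight_function_def boundary_edges_def)
  next
    case False
    have "minimal_filling M (affine_dist 1 (affine_dist 1 \<rho> a) (- a)) V E \<omega>"
      using min minimal_filling_cong[of M "affine_dist 1 (affine_dist 1 \<rho> a) (- a)" \<rho>]
        affine_dist_shift_back[OF pm] by blast
    then have "- a / 2 \<le> \<omega> e"
      using False by (intro minimal_filling_boundary_edge_ge[OF assms(1,2) pma _ _ tree deg2 M e]) auto
    then show ?thesis by linarith
  qed
  then show ?thesis using wf by (simp add: weight_function_def shifted_weight_def)
qed

text \<open>Fillings of \<open>\<rho> + a\<close> and of \<open>\<rho>\<close> are transformed into one another by shrinking balls and by
  adding pendant edges, with the same change of weight as that from \<open>\<omega>\<close> to \<open>\<omega>\<^sub>a\<close>.\<close>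

lemma minimal_filling_shift:
  fixes M :: "('v::infinite) set"
  assumes "finite M" and "3 \<le> card M" and pm: "pseudo_metric M \<rho>"
    and pma: "pseudo_metric M (affine_dist 1 \<rho> a)"
    and min: "minimal_filling M \<rho> V E \<omega>" and tree: "tree_graph V E"
    and deg2: "\<forall>v\<in>V. vertex_degree E v = 2 \<longrightarrow> v \<in> M"
    and M: "M = {v \<in> V. vertex_degree E v = 1}"
  shows "minimal_filling M (affine_dist 1 \<rho> a) V E (shifted_weight M E \<omega> a)"
  unfolding minimal_filling_def
proof (intro conjI allI impI)
  have fill: "filling M \<rho> V E \<omega>" using min by (simp add: minimal_filling_def)
  note f = fillingD[OF fill]
  have leaf: "v \<in> M \<longleftrightarrow> vertex_degree E v = 1" if "v \<in> V" for v using M that by blast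
  have card: "2 \<le> card M" "M \<noteq> {}" using assms(2) by auto
  show "filling M (affine_dist 1 \<rho> a) V E (shifted_weight M E \<omega> a)"
    using filling_shifted[OF f(1) assms(1,2) f(3) leaf fill]
      shifted_weight_nonneg[OF assms(1) card(1) pm pma min tree deg2 M] by blast
  fix V' E' \<omega>' assume fill': "filling M (affine_dist 1 \<rho> a) V' E' \<omega>'"
  have "graph_weight E \<omega> + card M * (a / 2) \<le> graph_weight E' \<omega>'"
  proof (cases "0 \<le> a")
    case True
    obtain \<omega>'' where \<omega>'': "filling M \<rho> V' E' \<omega>''"
      "graph_weight E' \<omega>'' + (\<Sum>r\<in>M. \<Sum>e\<in>E'. ball_part V' E' \<omega>' a r e) \<le> graph_weight E' \<omega>'"
      using filling_shrink_balls[OF assms(1) card(2) pm True fill'] by blast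
    have "(\<Sum>r\<in>M. a / 2) \<le> (\<Sum>r\<in>M. \<Sum>e\<in>E'. ball_part V' E' \<omega>' a r e)"
      by (intro sum_mono ball_length_ge[OF assms(1) card(1) pm True fill'])
    moreover have "graph_weight E \<omega> \<le> graph_weight E' \<omega>''"
      using min \<omega>''(1) by (simp add: minimal_filling_def)
    ultimately show ?thesis using \<omega>''(2) by simp
  next
    case False
    then obtain V'' E'' \<omega>'' where
      fill'': "filling M (affine_dist 1 (affine_dist 1 \<rho> a) (- a)) V'' E'' \<omega>''" and
      gw: "graph_weight E'' \<omega>'' = graph_weight E' \<omega>' + card M * (- a / 2)"
      using filling_add_pendants[OF assms(1) _ fill', of "- a"] by auto
    have "filling M \<rho> V'' E'' \<omega>''"
      using fill'' filling_cong[of M "affine_dist 1 (affine_dist 1 \<rho> a) (- a)" \<rho>]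
        affine_dist_shift_back[OF pm] by blast
    then have "graph_weight E \<omega> \<le> graph_weight E'' \<omega>''"
      using min by (simp add: minimal_filling_def)
    then show ?thesis using gw by simp
  qed
  then show "graph_weight E (shifted_weight M E \<omega> a) \<le> graph_weight E' \<omega>'"
    using graph_weight_shifted[OF f(1) assms(1,2) f(3) leaf] by simp
qed

section \<open>Types of minimal fillings\<close>

lemma filling_scale:
  assumes fill: "filling M \<rho> V E \<omega>" and "0 \<le> k"
    and scale: "\<And>x y. x \<in> M \<Longrightarrow> y \<in> M \<Longrightarrow> \<rho>' x y = k * \<rho> x y"
  shows "filling M \<rho>' V E (\<lambda>e. k * \<omega> e)"
  unfolding filling_def joins_def
proof (intro conjI ballI)
  note f = fillingD[OF fill]
  show "connected_graph V E" "M \<subseteq> V" using f by auto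
  show "weight_function E (\<lambda>e. k * \<omega> e)" using f(4) \<open>0 \<le> k\<close> by (simp add: weight_function_def)
  fix p q assume pq: "p \<in> M" "q \<in> M"
  show "\<rho>' p q \<le> weight_dist V E (\<lambda>e. k * \<omega> e) p q"
  proof (rule weight_dist_ge[OF f(1)])
    fix P assume "path_between V E p q P"
    then have "\<rho> p q \<le> path_weight \<omega> P"
      using f(5)[OF pq] weight_dist_le[OF f(1)] order_trans by blast
    then show "\<rho>' p q \<le> path_weight (\<lambda>e. k * \<omega> e) P"
      using \<open>0 \<le> k\<close> pq by (simp add: path_weight_scale scale mult_left_mono)
  qed (use f pq in auto)
qed

lemma minimal_filling_scale:
  assumes min: "minimal_filling M \<rho> V E \<omega>" and "0 \<le> k"
    and scale: "\<And>x y. x \<in> M \<Longrightarrow> y \<in> M \<Longrightarrow> \<rho>' x y = k * \<rho> x y"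
  shows "minimal_filling M \<rho>' V E (\<lambda>e. k * \<omega> e)"
  unfolding minimal_filling_def
proof (intro conjI allI impI)
  show "filling M \<rho>' V E (\<lambda>e. k * \<omega> e)"
    using filling_scale[of M \<rho> V E \<omega> k \<rho>', OF _ \<open>0 \<le> k\<close> scale] min
    by (simp add: minimal_filling_def)
  fix V' E' \<omega>' assume fill': "filling M \<rho>' V' E' \<omega>'"
  have k: "graph_weight E (\<lambda>e. k * \<omega> e) = k * graph_weight E \<omega>"
    by (simp add: graph_weight_def sum_distrib_left)
  show "graph_weight E (\<lambda>e. k * \<omega> e) \<le> graph_weight E' \<omega>'"
  proof (cases "k = 0")
    case True
    then show ?thesis
      using fillingD(4)[OF fill'] by (auto simp: graph_weight_def weight_function_def sum_nonneg)
  next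
    case False
    then have "filling M \<rho> V' E' (\<lambda>e. 1 / k * \<omega>' e)"
      using \<open>0 \<le> k\<close> scale by (intro filling_scale[OF fill']) auto
    then have "graph_weight E \<omega> \<le> graph_weight E' (\<lambda>e. 1 / k * \<omega>' e)"
      using min by (simp add: minimal_filling_def)
    also have "\<dots> = graph_weight E' \<omega>' / k" by (simp add: graph_weight_def sum_divide_distrib)
    finally show ?thesis using False \<open>0 \<le> k\<close> by (simp add: k field_simps)
  qed
qed

lemma minimal_filling_types_scale:
  assumes "0 \<le> k" and "\<And>x y. x \<in> M \<Longrightarrow> y \<in> M \<Longrightarrow> \<rho>' x y = k * \<rho> x y"
  shows "minimal_filling_types M \<rho> \<subseteq> minimal_filling_types M \<rho>'"
proof clarify
  fix V E assume "(V, E) \<in> minimal_filling_types M \<rho>"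
  moreover have "minimal_filling M \<rho>' V E (\<lambda>e. k * \<omega> e)" if "minimal_filling M \<rho> V E \<omega>" for \<omega>
    by (rule minimal_filling_scale[OF that assms])
  ultimately show "(V, E) \<in> minimal_filling_types M \<rho>'"
    unfolding minimal_filling_types_def by blast
qed

text \<open>With at least three points the types are compared by a shift. On two points \<open>\<rho> + c\<close> is
  positive, so \<open>\<rho> + t\<close> is a multiple of it.\<close>

lemma minimal_filling_types_shift:
  fixes M :: "('v::infinite) set"
  assumes "finite M" and "2 \<le> card M" and pm: "pseudo_metric M \<rho>" and "0 < c" and "0 \<le> t"
  shows "minimal_filling_types M (affine_dist 1 \<rho> c) \<subseteq> minimal_filling_types M (affine_dist 1 \<rho> t)"
proof (cases "card M = 2")
  case True
  then obtain p q where pq: "M = {p, q}" "p \<noteq> q" unfolding card_2_iff by blast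
  have "p \<in> M" "q \<in> M" using pq by auto
  then have \<rho>: "0 \<le> \<rho> p q" "\<rho> q p = \<rho> p q" using pm unfolding pseudo_metric_def by blast+
  show ?thesis
    by (rule minimal_filling_types_scale[where k = "(\<rho> p q + t) / (\<rho> p q + c)"])
       (use \<rho> pq assms(4,5) in \<open>auto simp: affine_dist_def\<close>)
next
  case False
  then have card: "3 \<le> card M" using assms(2) by linarith
  show ?thesis
  proof clarify
    fix V E assume "(V, E) \<in> minimal_filling_types M (affine_dist 1 \<rho> c)"
    then obtain \<omega> where tree: "tree_graph V E"
      and deg: "\<forall>v\<in>V. vertex_degree E v \<in> {1, 2} \<longrightarrow> v \<in> M"
      and min: "minimal_filling M (affine_dist 1 \<rho> c) V E \<omega>"
      by (auto simp: minimal_filling_types_def)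
    have MV: "M \<subseteq> V" using min fillingD(3) unfolding minimal_filling_def by blast
    have "vertex_degree E v = 1" if "v \<in> M" for v
      using minimal_filling_degree_eq_1[OF assms(1,2) pm \<open>0 < c\<close> min tree _ that] deg by blast
    then have M: "M = {v \<in> V. vertex_degree E v = 1}" using deg MV by auto
    have shift: "affine_dist 1 (affine_dist 1 \<rho> c) (t - c) = affine_dist 1 \<rho> t"
      by (intro ext) (simp add: affine_dist_def)
    have "minimal_filling M (affine_dist 1 (affine_dist 1 \<rho> c) (t - c)) V E
        (shifted_weight M E \<omega> (t - c))"
    proof (rule minimal_filling_shift[OF assms(1) card _ _ min tree _ M])
      show "pseudo_metric M (affine_dist 1 \<rho> c)" using pseudo_metric_shift[OF pm] \<open>0 < c\<close> by simp
      show "pseudo_metric M (affine_dist 1 (affine_dist 1 \<rho> c) (t - c))"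
        unfolding shift by (rule pseudo_metric_shift[OF pm \<open>0 \<le> t\<close>])
    qed (use deg in auto)
    then show "(V, E) \<in> minimal_filling_types M (affine_dist 1 \<rho> t)"
      using tree deg unfolding shift by (auto simp: minimal_filling_types_def)
  qed
qed

theorem theorem10p1:
  fixes M :: "('v::infinite) set" and \<rho> :: "'v \<Rightarrow> 'v \<Rightarrow> real"
    and V :: "'v set" and E :: "'v set set" and \<omega> :: "'v set \<Rightarrow> real"
    and a\<^sub>M b :: real
  assumes "finite M" and "M \<noteq> {}" and "pseudo_metric M \<rho>"
    and "minimal_filling M \<rho> V E \<omega>"
    and "tree_graph V E"
    and "\<forall>v\<in>V. vertex_degree E v = 2 \<longrightarrow> v \<in> M"
    and "M = {v \<in> V. vertex_degree E v = 1}"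
  defines "a\<^sub>M \<equiv> shift_threshold M \<rho>"
    and "b \<equiv> Min (\<omega> ` boundary_edges M E)"
  shows "- 2 * b \<le> a\<^sub>M \<and>
    (\<forall>a\<ge>a\<^sub>M. weight_function E (shifted_weight M E \<omega> a)) \<and>
    (3 \<le> card M \<longrightarrow>
       (\<forall>a\<ge>a\<^sub>M. minimal_filling M (affine_dist 1 \<rho> a) V E (shifted_weight M E \<omega> a))) \<and>
    (\<forall>l>0. \<forall>a>l * a\<^sub>M. \<forall>l'>0. \<forall>a'>l' * a\<^sub>M.
       minimal_filling_types M (affine_dist l \<rho> a) =
       minimal_filling_types M (affine_dist l' \<rho> a')) \<and>
    (\<forall>l>0. \<forall>a>l * a\<^sub>M. \<forall>l'\<ge>0.
       minimal_filling_types M (affine_dist l \<rho> a) \<subseteq>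
       minimal_filling_types M (affine_dist l' \<rho> (l' * a\<^sub>M)))"
proof -
  note fin = assms(1) and pm = assms(3) and min = assms(4) and tree = assms(5)
    and deg2 = assms(6) and M = assms(7)
  have fg: "finite_graph V E" using tree by (simp add: tree_graph_def connected_graph_def)
  have card: "2 \<le> card M" and bd: "boundary_edges M E \<noteq> {}"
    using tree_leaves_card_ge_2[OF fin assms(2) tree M] by auto
  have pma: "pseudo_metric M (affine_dist 1 \<rho> a)" if "a\<^sub>M \<le> a" for a
    using shift_threshold_iff[OF fin card pm] that by (simp add: a\<^sub>M_def)
  have nonneg: "weight_function E (shifted_weight M E \<omega> a)" if "a\<^sub>M \<le> a" for a
    by (rule shifted_weight_nonneg[OF fin card pm pma[OF that] min tree deg2 M])
  have "finite (boundary_edges M E)"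
    using finite_graph_finite_edges[OF fg] by (auto simp: boundary_edges_def)
  then have "b \<in> \<omega> ` boundary_edges M E" unfolding b_def using bd by (intro Min_in) auto
  then obtain e where e: "e \<in> boundary_edges M E" "b = \<omega> e" by blast
  then have "0 \<le> shifted_weight M E \<omega> a\<^sub>M e"
    using nonneg[of a\<^sub>M] by (simp add: weight_function_def boundary_edges_def)
  then have "0 \<le> b + a\<^sub>M / 2" using e by (simp add: shifted_weight_def)
  then have "- 2 * b \<le> a\<^sub>M" by linarith
  moreover have "minimal_filling M (affine_dist 1 \<rho> a) V E (shifted_weight M E \<omega> a)"
    if "3 \<le> card M" "a\<^sub>M \<le> a" for a
    by (rule minimal_filling_shift[OF fin that(1) pm pma[OF that(2)] min tree deg2 M])
  moreover have types: "minimal_filling_types M (affine_dist l \<rho> a) \<subseteq>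
      minimal_filling_types M (affine_dist l' \<rho> a')"
    if "0 < l" "l * a\<^sub>M < a" "0 \<le> l'" "l' * a\<^sub>M \<le> a'" "l' = 0 \<Longrightarrow> a' = 0" for l a l' a'
  proof (cases "l' = 0")
    case True
    then show ?thesis using that(5)
      by (intro minimal_filling_types_scale[where k = 0]) (auto simp: affine_dist_def)
  next
    case False
    then have "0 < l'" using that by linarith
    let ?\<beta> = "affine_dist 1 \<rho> a\<^sub>M"
    \<comment> \<open>All these spaces are positive multiples of shifts of \<open>\<rho> + a\<^sub>M\<close>.\<close>
    have \<beta>: "affine_dist s \<rho> x y z = s * affine_dist 1 ?\<beta> (x / s - a\<^sub>M) y z" if "0 < s" for s x y z
      using that by (simp add: affine_dist_def field_simps)
    have "minimal_filling_types M (affine_dist l \<rho> a) \<subseteq>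
        minimal_filling_types M (affine_dist 1 ?\<beta> (a / l - a\<^sub>M))"
      by (rule minimal_filling_types_scale[where k = "1 / l"]) (use that(1) \<beta> in auto)
    also have "\<dots> \<subseteq> minimal_filling_types M (affine_dist 1 ?\<beta> (a' / l' - a\<^sub>M))"
      by (rule minimal_filling_types_shift[OF fin card pma[OF order_refl]])
         (use that(1,2,4) \<open>0 < l'\<close> in \<open>auto simp: field_simps\<close>)
    also have "\<dots> \<subseteq> minimal_filling_types M (affine_dist l' \<rho> a')"
      by (rule minimal_filling_types_scale[where k = l']) (use \<open>0 < l'\<close> \<beta> in auto)
    finally show ?thesis .
  qed
  have "minimal_filling_types M (affine_dist l \<rho> a) = minimal_filling_types M (affine_dist l' \<rho> a')"
    if "0 < l" "l * a\<^sub>M < a" "0 < l'" "l' * a\<^sub>M < a'" for l a l' a'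
    using types[of l a l' a'] types[of l' a' l a] that by (intro equalityI) auto
  moreover have "minimal_filling_types M (affine_dist l \<rho> a) \<subseteq>
      minimal_filling_types M (affine_dist l' \<rho> (l' * a\<^sub>M))"
    if "0 < l" "l * a\<^sub>M < a" "0 \<le> l'" for l a l'
    using types[OF that] by simp
  ultimately show ?thesis using nonneg by blast
qed

end
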